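(* Let $d\ge2$. There exists a constant $C\ge1$ depending only on $d$ such that the following holds. Let $\mu=\sum_{i=1}^nm_i\delta_{y_i}$ be a discrete probability measure on $\mathbb R^d$ where all masses $m_i$ are positive and all points $y_i$ are distinct, and let $l_\mu=\min_{i\ne j}|y_i-y_j|$. If $\nu\in\mathcal P_2(\mathbb R^d)$ satisfies $W_\infty(\mu,\nu)<\frac{l_\mu}{4Cn}$, then $$0\le\frac1dW^2(\mu,\nu)-SW^2(\mu,\nu)\le\frac{4Cn}{l_\mu}W_\infty(\mu,\nu)\,SW^2(\mu,\nu).$$ Thus $$SW^2(\mu,\nu)\le\ell_{SW}^2(\mu,\nu)\le\frac1dW^2(\mu,\nu)\le\big(1+4Cn\,l_\mu^{-1}W_\infty(\mu,\nu)\big)SW^2(\mu,\nu).$$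
   Context: $\mathcal P_2(\mathbb R^d)$ is the set of Borel probability measures on $\mathbb R^d$ with finite second moment, $W$ the quadratic Wasserstein distance, $W_\infty(\mu,\nu)=\inf_{\gamma\in\Gamma(\mu,\nu)}\gamma\text{-}\operatorname{ess\,sup}|x-y|$ with $\Gamma(\mu,\nu)$ the set of couplings, $\sigma$ the uniform probability measure on $\mathbb S^{d-1}$. For $\theta\in\mathbb S^{d-1}$, $\hat\mu^\theta$ is the pushforward of $\mu$ under $x\mapsto x\cdot\theta$, and $SW^2(\mu,\nu)=\int_{\mathbb S^{d-1}}W^2(\hat\mu^\theta,\hat\nu^\theta)\,d\sigma(\theta)$. Length metric: a curve $(\mu_t)_{t\in[0,1]}$ in $\mathcal P_2(\mathbb R^d)$ is absolutely continuous in $SW$ if there is $g\in L^1(0,1)$ with $SW(\mu_s,\mu_t)\le\int_s^tg$ for all $s\le t$; its metric derivative $|\mu'|_{SW}(t)=\lim_{s\to t}SW(\mu_s,\mu_t)/|s-t|$ exists a.e., and $\ell_{SW}(\mu,\nu)=\inf\int_0^1|\mu'|_{SW}(t)\,dt$ over all such curves with $\mu_0=\mu$, $\mu_1=\nu$. For $n=1$ the minimum over the empty set is $l_\mu=+\infty$ and $1/l_\mu=0$. *)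

theory Defs
  imports "HOL-Probability.Probability"
begin

section \<open>Measures, couplings and Wasserstein distances\<close>

definition P2 :: "'a::euclidean_space measure set" where
  "P2 = {\<mu>. sets \<mu> = sets borel \<and> prob_space \<mu> \<and> integrable \<mu> (\<lambda>x. (norm x)\<^sup>2)}"

definition couplings ::
    "'a::euclidean_space measure \<Rightarrow> 'a measure \<Rightarrow> ('a \<times> 'a) measure set" where
  "couplings \<mu> \<nu> =
     {\<gamma>. sets \<gamma> = sets (borel \<Otimes>\<^sub>M borel) \<and> distr \<gamma> borel fst = \<mu> \<and> distr \<gamma> borel snd = \<nu>}"

text \<open>The distances \<open>W\<close> and \<open>SW\<close> are real valued and only meant for arguments in \<open>P2\<close>, where the
  infimum and the integral below are finite, so that \<open>enn2real\<close> loses nothing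
  (see \<open>W_INF_finite\<close> and \<open>SW_integral_finite\<close>).\<close>

definition W :: "'a::euclidean_space measure \<Rightarrow> 'a measure \<Rightarrow> real" where
  "W \<mu> \<nu> = sqrt (enn2real
     (INF \<gamma>\<in>couplings \<mu> \<nu>. \<integral>\<^sup>+ z. ennreal ((dist (fst z) (snd z))\<^sup>2) \<partial>\<gamma>))"

definition W_infty :: "'a::euclidean_space measure \<Rightarrow> 'a measure \<Rightarrow> ereal" where
  "W_infty \<mu> \<nu> = (INF \<gamma>\<in>couplings \<mu> \<nu>. esssup \<gamma> (\<lambda>z. ereal (dist (fst z) (snd z))))"

section \<open>The sliced Wasserstein distance\<close>

text \<open>Normalised surface measure of the unit sphere, viewed as a Borel measure on the whole space:
  in polar coordinates the uniform distribution on the unit ball has direction \<open>x / |x|\<close>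
  distributed uniformly on the sphere. The point \<open>x = 0\<close> is Lebesgue-null.\<close>

definition unif_sphere :: "'a::euclidean_space measure" where
  "unif_sphere = distr (uniform_measure lborel (ball 0 1)) borel (\<lambda>x. x /\<^sub>R norm x)"

definition proj :: "'a::euclidean_space \<Rightarrow> 'a measure \<Rightarrow> real measure" where
  "proj \<theta> \<mu> = distr \<mu> borel (\<lambda>x. x \<bullet> \<theta>)"

definition SW :: "'a::euclidean_space measure \<Rightarrow> 'a measure \<Rightarrow> real" where
  "SW \<mu> \<nu> = sqrt (enn2real (\<integral>\<^sup>+ \<theta>. ennreal ((W (proj \<theta> \<mu>) (proj \<theta> \<nu>))\<^sup>2) \<partial>unif_sphere))"

section \<open>The length metric of the sliced Wasserstein distance\<close>

definition SW_abs_continuous :: "(real \<Rightarrow> 'a::euclidean_space measure) \<Rightarrow> bool" where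
  "SW_abs_continuous c \<longleftrightarrow>
     (\<forall>t\<in>{0..1}. c t \<in> P2) \<and>
     (\<exists>g::real \<Rightarrow> real. set_integrable lborel {0<..<1} g \<and>
        (\<forall>s t. 0 \<le> s \<longrightarrow> s \<le> t \<longrightarrow> t \<le> 1 \<longrightarrow>
           SW (c s) (c t) \<le> (LINT r:{s<..<t}|lborel. g r)))"

text \<open>Along an absolutely continuous curve the limit exists for almost every \<open>t\<close>; elsewhere
  \<open>Lim\<close> has an unspecified value, which does not affect the length.\<close>

definition SW_metric_deriv :: "(real \<Rightarrow> 'a::euclidean_space measure) \<Rightarrow> real \<Rightarrow> real" where
  "SW_metric_deriv c t = Lim (at t within {0..1}) (\<lambda>s. SW (c s) (c t) / \<bar>s - t\<bar>)"

definition SW_length :: "(real \<Rightarrow> 'a::euclidean_space measure) \<Rightarrow> ereal" where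
  "SW_length c = enn2ereal (\<integral>\<^sup>+ t\<in>{0..1}. ennreal (SW_metric_deriv c t) \<partial>lborel)"

definition ell_SW :: "'a::euclidean_space measure \<Rightarrow> 'a measure \<Rightarrow> ereal" where
  "ell_SW \<mu> \<nu> = (INF c\<in>{c. SW_abs_continuous c \<and> c 0 = \<mu> \<and> c 1 = \<nu>}. SW_length c)"

section \<open>Discrete measures\<close>

definition discrete_measure ::
    "nat \<Rightarrow> (nat \<Rightarrow> real) \<Rightarrow> (nat \<Rightarrow> 'a::euclidean_space) \<Rightarrow> 'a measure" where
  "discrete_measure n m y = distr (point_measure {1..n} (\<lambda>i. ennreal (m i))) borel y"

text \<open>For at most one point the infimum is over the empty set and equals \<open>\<infinity>\<close>.\<close>

definition min_separation :: "nat \<Rightarrow> (nat \<Rightarrow> 'a::euclidean_space) \<Rightarrow> ereal" where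
  "min_separation n y =
     (INF (i, j)\<in>{(i, j). i \<in> {1..n} \<and> j \<in> {1..n} \<and> i \<noteq> j}. ereal (dist (y i) (y j)))"

section \<open>Sanity checks\<close>

lemma emeasure_discrete_measure:
  assumes "A \<in> sets borel"
  shows "emeasure (discrete_measure n m y) A =
           (\<Sum>i=1..n. ennreal (m i) * emeasure (return borel (y i)) A)"
proof -
  have "emeasure (discrete_measure n m y) A =
          emeasure (point_measure {1..n} (\<lambda>i. ennreal (m i))) (y -` A \<inter> {1..n})"
    unfolding discrete_measure_def using assms
    by (subst emeasure_distr) (auto simp: space_point_measure)
  also have "\<dots> = (\<Sum>i\<in>y -` A \<inter> {1..n}. ennreal (m i))"
    by (subst emeasure_point_measure_finite) auto
  also have "\<dots> = (\<Sum>i=1..n. ennreal (m i) * emeasure (return borel (y i)) A)"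
    using assms by (intro sum.mono_neutral_cong_left) (auto simp: indicator_def)
  finally show ?thesis .
qed

lemma space_unif_sphere [simp]: "space unif_sphere = UNIV"
  and sets_unif_sphere [simp]: "sets unif_sphere = sets borel"
  by (auto simp: unif_sphere_def)

lemma emeasure_unit_ball:
  "emeasure lborel (ball (0::'a::euclidean_space) 1) \<noteq> 0"
  "emeasure lborel (ball (0::'a::euclidean_space) 1) \<noteq> \<infinity>"
  using emeasure_ball[of 1 "0::'a"]
    less_imp_neq[OF unit_ball_vol_pos[of "real DIM('a)"]] by auto

lemma prob_space_unif_sphere: "prob_space (unif_sphere :: 'a::euclidean_space measure)"
  unfolding unif_sphere_def
  by (intro prob_space.prob_space_distr prob_space_uniform_measure emeasure_unit_ball) auto

lemma AE_unif_sphere: "AE \<theta> in (unif_sphere :: 'a::euclidean_space measure). norm \<theta> = 1"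
proof -
  have "AE x in lborel. (x::'a) \<noteq> 0"
    by (rule AE_lborel_singleton)
  then have "AE x in uniform_measure lborel (ball (0::'a) 1). norm (x /\<^sub>R norm x) = 1"
    by (intro AE_uniform_measureI) auto
  then show ?thesis
    unfolding unif_sphere_def by (subst AE_distr_iff) auto
qed

lemma pair_measure_coupling:
  assumes "\<mu> \<in> P2" "\<nu> \<in> P2"
  shows "\<mu> \<Otimes>\<^sub>M \<nu> \<in> couplings \<mu> \<nu>"
proof -
  interpret M: prob_space \<mu> using assms by (simp add: P2_def)
  interpret N: prob_space \<nu> using assms by (simp add: P2_def)
  interpret pair_prob_space \<mu> \<nu> ..
  have s: "sets \<mu> = sets borel" "sets \<nu> = sets borel" using assms by (auto simp: P2_def)
  have "distr (\<mu> \<Otimes>\<^sub>M \<nu>) borel fst = distr (\<mu> \<Otimes>\<^sub>M \<nu>) \<mu> fst"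
    by (rule distr_cong) (auto simp: s)
  also have "\<dots> = \<mu>" by (rule N.distr_pair_fst)
  finally have 1: "distr (\<mu> \<Otimes>\<^sub>M \<nu>) borel fst = \<mu>" .
  have "distr (\<mu> \<Otimes>\<^sub>M \<nu>) borel snd = distr (\<mu> \<Otimes>\<^sub>M \<nu>) \<nu> snd"
    by (rule distr_cong) (auto simp: s)
  also have "\<dots> = \<nu>"
  proof (rule measure_eqI)
    fix A assume A: "A \<in> sets (distr (\<mu> \<Otimes>\<^sub>M \<nu>) \<nu> snd)"
    have "emeasure (distr (\<mu> \<Otimes>\<^sub>M \<nu>) \<nu> snd) A = emeasure (\<mu> \<Otimes>\<^sub>M \<nu>) (space \<mu> \<times> A)"
      using A sets.sets_into_space[of A \<nu>]
      by (subst emeasure_distr) (auto simp: space_pair_measure intro!: arg_cong[where f="emeasure _"])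
    then show "emeasure (distr (\<mu> \<Otimes>\<^sub>M \<nu>) \<nu> snd) A = emeasure \<nu> A"
      using A by (simp add: N.emeasure_pair_measure_Times M.emeasure_space_1)
  qed simp
  finally have 2: "distr (\<mu> \<Otimes>\<^sub>M \<nu>) borel snd = \<nu>" .
  show ?thesis
    using 1 2 s by (auto simp: couplings_def intro!: sets_pair_measure_cong)
qed

lemma nn_integral_dist_coupling:
  assumes "\<mu> \<in> P2" "\<nu> \<in> P2" "\<gamma> \<in> couplings \<mu> \<nu>"
  shows "(\<integral>\<^sup>+ z. ennreal ((dist (fst z) (snd z))\<^sup>2) \<partial>\<gamma>) \<le>
           2 * (\<integral>\<^sup>+ x. ennreal ((norm x)\<^sup>2) \<partial>\<mu>) + 2 * (\<integral>\<^sup>+ y. ennreal ((norm y)\<^sup>2) \<partial>\<nu>)"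
proof -
  have g [measurable_cong]: "sets \<gamma> = sets (borel \<Otimes>\<^sub>M borel)"
    and m: "distr \<gamma> borel fst = \<mu>" "distr \<gamma> borel snd = \<nu>"
    using assms(3) by (auto simp: couplings_def)
  have [measurable]: "fst \<in> measurable \<gamma> borel" "snd \<in> measurable \<gamma> borel"
    by measurable
  have le: "(dist x y)\<^sup>2 \<le> 2 * (norm x)\<^sup>2 + 2 * (norm y)\<^sup>2" for x y :: 'a
  proof -
    have "(dist x y)\<^sup>2 \<le> (norm x + norm y)\<^sup>2"
      by (intro power_mono) (auto simp: dist_norm norm_triangle_ineq4)
    also have "\<dots> \<le> 2 * (norm x)\<^sup>2 + 2 * (norm y)\<^sup>2"
      using zero_le_power2[of "norm x - norm y"] by (simp add: power2_eq_square algebra_simps)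
    finally show ?thesis .
  qed
  have le': "ennreal ((dist x y)\<^sup>2) \<le> 2 * ennreal ((norm x)\<^sup>2) + 2 * ennreal ((norm y)\<^sup>2)"
    for x y :: 'a
    using ennreal_leI[OF le[of x y]] by (simp add: ennreal_plus ennreal_mult)
  have "(\<integral>\<^sup>+ z. ennreal ((dist (fst z) (snd z))\<^sup>2) \<partial>\<gamma>) \<le>
          (\<integral>\<^sup>+ z. 2 * ennreal ((norm (fst z))\<^sup>2) + 2 * ennreal ((norm (snd z))\<^sup>2) \<partial>\<gamma>)"
    by (intro nn_integral_mono le')
  also have "\<dots> = 2 * (\<integral>\<^sup>+ z. ennreal ((norm (fst z))\<^sup>2) \<partial>\<gamma>) +
                  2 * (\<integral>\<^sup>+ z. ennreal ((norm (snd z))\<^sup>2) \<partial>\<gamma>)"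
    by (simp add: nn_integral_add nn_integral_cmult)
  also have "(\<integral>\<^sup>+ z. ennreal ((norm (fst z))\<^sup>2) \<partial>\<gamma>) = (\<integral>\<^sup>+ x. ennreal ((norm x)\<^sup>2) \<partial>\<mu>)"
    unfolding m(1)[symmetric] by (subst nn_integral_distr) auto
  also have "(\<integral>\<^sup>+ z. ennreal ((norm (snd z))\<^sup>2) \<partial>\<gamma>) = (\<integral>\<^sup>+ x. ennreal ((norm x)\<^sup>2) \<partial>\<nu>)"
    unfolding m(2)[symmetric] by (subst nn_integral_distr) auto
  finally show ?thesis .
qed

lemma P2_moment_finite:
  assumes "\<mu> \<in> P2"
  shows "(\<integral>\<^sup>+ x. ennreal ((norm x)\<^sup>2) \<partial>\<mu>) < \<infinity>"
  using assms by (auto simp: P2_def integrable_iff_bounded)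

lemma W_INF_le:
  assumes "\<mu> \<in> P2" "\<nu> \<in> P2"
  shows "(INF \<gamma>\<in>couplings \<mu> \<nu>. \<integral>\<^sup>+ z. ennreal ((dist (fst z) (snd z))\<^sup>2) \<partial>\<gamma>) \<le>
           2 * (\<integral>\<^sup>+ x. ennreal ((norm x)\<^sup>2) \<partial>\<mu>) + 2 * (\<integral>\<^sup>+ y. ennreal ((norm y)\<^sup>2) \<partial>\<nu>)"
  by (rule INF_lower2, rule pair_measure_coupling[OF assms],
      rule nn_integral_dist_coupling[OF assms pair_measure_coupling[OF assms]])

lemma W_INF_finite:
  assumes "\<mu> \<in> P2" "\<nu> \<in> P2"
  shows "(INF \<gamma>\<in>couplings \<mu> \<nu>. \<integral>\<^sup>+ z. ennreal ((dist (fst z) (snd z))\<^sup>2) \<partial>\<gamma>) < \<infinity>"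
  by (rule le_less_trans[OF W_INF_le[OF assms]])
    (use P2_moment_finite[OF assms(1)] P2_moment_finite[OF assms(2)]
      in \<open>auto simp: ennreal_mult_less_top\<close>)

lemma nn_integral_proj_le:
  assumes "\<mu> \<in> P2" "norm \<theta> = 1"
  shows "(\<integral>\<^sup>+ x. ennreal ((norm x)\<^sup>2) \<partial>proj \<theta> \<mu>) \<le> (\<integral>\<^sup>+ x. ennreal ((norm x)\<^sup>2) \<partial>\<mu>)"
proof -
  have [measurable_cong]: "sets \<mu> = sets borel" using assms by (simp add: P2_def)
  have "(\<integral>\<^sup>+ x. ennreal ((norm x)\<^sup>2) \<partial>proj \<theta> \<mu>) = (\<integral>\<^sup>+ x. ennreal ((x \<bullet> \<theta>)\<^sup>2) \<partial>\<mu>)"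
    unfolding proj_def by (subst nn_integral_distr) auto
  also have "\<dots> \<le> (\<integral>\<^sup>+ x. ennreal ((norm x)\<^sup>2) \<partial>\<mu>)"
  proof (intro nn_integral_mono ennreal_leI)
    fix x
    have "\<bar>x \<bullet> \<theta>\<bar> \<le> norm x"
      using Cauchy_Schwarz_ineq2[of x \<theta>] assms(2) by simp
    then show "(x \<bullet> \<theta>)\<^sup>2 \<le> (norm x)\<^sup>2"
      using abs_le_square_iff[of "x \<bullet> \<theta>" "norm x"] by simp
  qed
  finally show ?thesis .
qed

lemma proj_P2:
  assumes "\<mu> \<in> P2" "norm \<theta> = 1"
  shows "proj \<theta> \<mu> \<in> P2"
proof -
  have [measurable_cong]: "sets \<mu> = sets borel" and "prob_space \<mu>"
    using assms by (auto simp: P2_def)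
  then have "prob_space (proj \<theta> \<mu>)"
    unfolding proj_def by (intro prob_space.prob_space_distr) auto
  moreover have "integrable (proj \<theta> \<mu>) (\<lambda>x. (norm x)\<^sup>2)"
    using nn_integral_proj_le[OF assms] P2_moment_finite[OF assms(1)]
    by (auto simp: integrable_iff_bounded proj_def intro: le_less_trans)
  ultimately show ?thesis by (simp add: P2_def proj_def)
qed

lemma SW_integral_finite:
  fixes \<mu> \<nu> :: "'a::euclidean_space measure"
  assumes "\<mu> \<in> P2" "\<nu> \<in> P2"
  shows "(\<integral>\<^sup>+ \<theta>. ennreal ((W (proj \<theta> \<mu>) (proj \<theta> \<nu>))\<^sup>2) \<partial>unif_sphere) < \<infinity>"
proof -
  interpret S: prob_space "unif_sphere :: 'a measure" by (rule prob_space_unif_sphere)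
  define K where "K = 2 * (\<integral>\<^sup>+ x. ennreal ((norm x)\<^sup>2) \<partial>\<mu>) + 2 * (\<integral>\<^sup>+ y. ennreal ((norm y)\<^sup>2) \<partial>\<nu>)"
  have K: "K < \<infinity>"
    using P2_moment_finite[OF assms(1)] P2_moment_finite[OF assms(2)]
    by (auto simp: K_def ennreal_mult_less_top)
  have "ennreal ((W (proj \<theta> \<mu>) (proj \<theta> \<nu>))\<^sup>2) \<le> K" if "norm \<theta> = 1" for \<theta> :: 'a
  proof -
    note P = proj_P2[OF assms(1) that] proj_P2[OF assms(2) that]
    have "ennreal ((W (proj \<theta> \<mu>) (proj \<theta> \<nu>))\<^sup>2) =
        (INF \<gamma>\<in>couplings (proj \<theta> \<mu>) (proj \<theta> \<nu>).
           \<integral>\<^sup>+ z. ennreal ((dist (fst z) (snd z))\<^sup>2) \<partial>\<gamma>)"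
      using W_INF_finite[OF P] by (simp add: W_def)
    also have "\<dots> \<le> K"
      unfolding K_def
      by (rule order_trans[OF W_INF_le[OF P]])
        (intro add_mono mult_left_mono nn_integral_proj_le assms that; simp)
    finally show ?thesis .
  qed
  then have "(\<integral>\<^sup>+ \<theta>. ennreal ((W (proj \<theta> \<mu>) (proj \<theta> \<nu>))\<^sup>2) \<partial>unif_sphere) \<le>
      (\<integral>\<^sup>+ \<theta>. K \<partial>(unif_sphere :: 'a measure))"
    by (intro nn_integral_mono_AE) (use AE_unif_sphere in \<open>auto elim: eventually_mono\<close>)
  also have "\<dots> = K"
    using S.emeasure_space_1 by simp
  finally show ?thesis using K by auto
qed

end

theory Submission
  imports Defs
begin

text \<open>For a coupling \<open>\<gamma>\<close> that is almost optimal for \<open>W\<^sub>\<infinity>\<close>, mass moves by at most \<open>w\<close>. In a direction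
  \<open>\<theta>\<close> in which a given atom stays \<open>2 w\<close> away from the others after projection, no coupling of the
  projections can move the mass near that atom more cheaply than \<open>\<gamma>\<close> does. The remaining directions
  have measure \<open>O(n w / l)\<close>, and averaging \<open>\<bar>v \<bullet> \<theta>\<bar>\<^sup>2\<close> over the sphere gives \<open>\<bar>v\<bar>\<^sup>2 / d\<close>.

  Displacement interpolation along a coupling is \<open>SW\<close>-Lipschitz with constant the square root of
  its cost divided by \<open>d\<close>, which bounds the length distance from above. For the lower bound the metric
  derivative has to exist almost everywhere, and \<open>SW\<close> has to satisfy the triangle inequality; the
  latter comes from the isometry of one-dimensional Wasserstein space with quantile functions
  in \<open>L\<^sup>2(0,1)\<close>.\<close>

section \<open>Lebesgue differentiation and metric derivatives on the line\<close>

text \<open>The error has to be a multiple of \<open>SW\<close> squared, so an error of order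
  \<open>w\<close> squared would be useless. The average over directions is therefore taken for one
  atom x and one destination z at a time: a bad direction loses at most |z - x|^2, and integrating
  over \<open>\<gamma>\<close> returns the cost \<open>k\<close> of \<open>\<gamma>\<close> itself
  times a small factor, which is absorbed on the left. Bounding the projected cost at z from below
  by the squared distance to the nearest projected atom makes the bad directions depend only on the
  atom x that z came from, so that a union bound involves fewer than n strips. If
  \<open>K * t\<close> bounds the sphere measure of a strip of half-width t, strips of half-width
  2w/l produce a relative error at most e = 2Cnw/l with C = max(1, dK). Smallness means e < 1/2,
  whence 1/(1-e) is at most 1 + 2e, and 2e = 4Cnw/l. Since \<open>W_infty\<close> is an infimum, the
  estimate is first shown for every w above it, and then w decreases to it.\<close>

lemma AE_lborel_not_negligible:
  assumes "negligible N"
  shows "AE x in lborel. x \<notin> N"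
proof -
  obtain N' where "N' \<in> null_sets lborel" "N \<subseteq> N'"
    using assms by (auto simp: negligible_iff_null_sets null_sets_completion_iff2)
  then show ?thesis by (intro AE_I'[of N']) auto
qed

lemma set_lebesgue_integral_Ioo_eq_integral:
  fixes h :: "real \<Rightarrow> real"
  assumes "integrable lborel h"
  shows "(LINT r:{a<..<b}|lborel. h r) = integral {a..b} h"
proof -
  have "set_integrable lborel {a<..<b} h"
    using assms unfolding set_integrable_def by (intro integrable_mult_indicator) auto
  from set_borel_integral_eq_integral(2)[OF this] show ?thesis
    by (simp add: integral_open_interval_real)
qed

text \<open>In dimension one a cube with lower corner \<open>t\<close> is an interval to the right
  of \<open>t\<close>, so the differentiation theorem for such cubes covers right-hand
  averages.\<close>

lemma AE_right_average_tendsto: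
  fixes h :: "real \<Rightarrow> real"
  assumes h: "integrable lborel h"
  shows "AE t in lborel. ((\<lambda>k. (LINT r:{t<..<t + k}|lborel. h r) / k) \<longlongrightarrow> h t) (at_right 0)"
proof -
  have "h integrable_on cbox a b" for a b
  proof -
    have "set_integrable lborel (cbox a b) h"
      using h unfolding set_integrable_def by (intro integrable_mult_indicator) auto
    from set_borel_integral_eq_integral(1)[OF this] show ?thesis .
  qed
  then obtain N where N: "negligible N"
    "\<And>x e. x \<notin> N \<Longrightarrow> 0 < e \<Longrightarrow> \<exists>d>0. \<forall>k. 0 < k \<and> k < d \<longrightarrow>
       norm (integral (cbox x (x + k *\<^sub>R One)) h /\<^sub>R k ^ DIM(real) - h x) < e"
    using integrable_ccontinuous_explicit[of h] by blast
  have "((\<lambda>k. (LINT r:{t<..<t + k}|lborel. h r) / k) \<longlongrightarrow> h t) (at_right 0)" if "t \<notin> N" for t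
  proof (rule tendstoI)
    fix e :: real assume "e > 0"
    from N(2)[OF that this] obtain d where d: "d > 0"
      "\<And>k. 0 < k \<Longrightarrow> k < d \<Longrightarrow> norm (integral {t..t + k} h / k - h t) < e"
      by (auto simp: divide_inverse_commute)
    show "\<forall>\<^sub>F k in at_right 0. dist ((LINT r:{t<..<t + k}|lborel. h r) / k) (h t) < e"
      unfolding eventually_at_right_field
      using d by (auto simp: set_lebesgue_integral_Ioo_eq_integral[OF h] dist_norm intro!: exI[of _ d])
  qed
  then show ?thesis
    using AE_lborel_not_negligible[OF N(1)] by (auto elim: eventually_mono)
qed

text \<open>Left-hand averages of \<open>h\<close> are right-hand averages of its reflection, and
  reflection preserves Lebesgue measure.\<close>

lemma AE_average_tendsto:
  fixes h :: "real \<Rightarrow> real"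
  assumes h: "integrable lborel h"
  shows "AE t in lborel.
    ((\<lambda>s. (LINT r:{min s t<..<max s t}|lborel. h r) / \<bar>s - t\<bar>) \<longlongrightarrow> h t) (at t)"
proof -
  have h': "integrable lborel (\<lambda>x. h (- x))"
    using h lborel_integrable_real_affine[of h "-1" 0] by simp
  have "AE t in distr lborel borel uminus.
      ((\<lambda>k. (LINT r:{t<..<t + k}|lborel. h (- r)) / k) \<longlongrightarrow> h (- t)) (at_right 0)"
    unfolding lborel_distr_uminus by (rule AE_right_average_tendsto[OF h'])
  then have "AE t in lborel.
      ((\<lambda>k. (LINT r:{- t<..<- t + k}|lborel. h (- r)) / k) \<longlongrightarrow> h (- (- t))) (at_right 0)"
    by (rule AE_distrD[rotated]) simp
  moreover have "(LINT r:{- t<..<- t + k}|lborel. h (- r)) = (LINT r:{t - k<..<t}|lborel. h r)" for t k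
  proof -
    have "(LINT r:{- t<..<- t + k}|lborel. h (- r)) =
        (LINT r|lborel. indicator {t - k<..<t} (- r) *\<^sub>R h (- r))"
      unfolding set_lebesgue_integral_def
      by (intro Bochner_Integration.integral_cong) (auto simp: indicator_def)
    also have "\<dots> = (LINT r:{t - k<..<t}|lborel. h r)"
      using lborel_integral_real_affine[of "-1" "\<lambda>r. indicator {t - k<..<t} r *\<^sub>R h r" 0]
      by (simp add: set_lebesgue_integral_def)
    finally show ?thesis .
  qed
  ultimately have L: "AE t in lborel.
      ((\<lambda>k. (LINT r:{t - k<..<t}|lborel. h r) / k) \<longlongrightarrow> h t) (at_right 0)"
    by simp
  show ?thesis
    using L AE_right_average_tendsto[OF h]
  proof eventually_elim
    case (elim t)
    have "((\<lambda>s. (LINT r:{min s t<..<max s t}|lborel. h r) / \<bar>s - t\<bar>) \<longlongrightarrow> h t) (at_right t)"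
      unfolding filterlim_at_right_to_0[of _ _ t]
      by (rule Lim_transform_eventually[OF elim(2)])
        (auto simp: eventually_at_right_field add.commute intro!: exI[of _ 1])
    moreover have "((\<lambda>s. (LINT r:{min s t<..<max s t}|lborel. h r) / \<bar>s - t\<bar>) \<longlongrightarrow> h t) (at_left t)"
      unfolding filterlim_at_left_to_right filterlim_at_right_to_0[of _ _ "- t"]
      by (rule Lim_transform_eventually[OF elim(1)])
        (auto simp: eventually_at_right_field add.commute intro!: exI[of _ 1])
    ultimately show ?case by (rule filterlim_split_at_real[rotated])
  qed
qed

lemma set_integrable_lborel_subset:
  fixes h :: "real \<Rightarrow> real"
  assumes "integrable lborel h" "A \<in> sets borel"
  shows "set_integrable lborel A h"
  using assms unfolding set_integrable_def by (intro integrable_mult_indicator) auto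

lemma set_integral_Ioo_combine:
  fixes h :: "real \<Rightarrow> real"
  assumes "integrable lborel h" "a \<le> b" "b \<le> c"
  shows "(LINT r:{a<..<b}|lborel. h r) + (LINT r:{b<..<c}|lborel. h r) =
    (LINT r:{a<..<c}|lborel. h r)"
proof -
  have "set_integrable lborel {a..c} h"
    using assms(1) by (rule set_integrable_lborel_subset) auto
  then have "h integrable_on {a..c}"
    by (rule set_borel_integral_eq_integral(1))
  then show ?thesis
    using assms by (simp add: set_lebesgue_integral_Ioo_eq_integral Henstock_Kurzweil_Integration.integral_combine)
qed

lemma set_integral_Ioo_tendsto_0:
  fixes h :: "real \<Rightarrow> real"
  assumes h: "integrable lborel h"
  shows "((\<lambda>t. LINT r:{min s t<..<max s t}|lborel. h r) \<longlongrightarrow> 0) (at s)"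
proof -
  \<comment> \<open>The base point \<open>s - 1\<close> leaves room on both sides of
    \<open>s\<close>, so that \<open>J\<close> is continuous at \<open>s\<close> from the left as
    well.\<close>
  define J where "J t = integral {s - 1..t} h" for t
  have "set_integrable lborel {s - 1..s + 1} h"
    using h by (rule set_integrable_lborel_subset) auto
  then have "h integrable_on {s - 1..s + 1}"
    by (rule set_borel_integral_eq_integral(1))
  then have "continuous_on {s - 1..s + 1} J"
    unfolding J_def by (rule indefinite_integral_continuous_1)
  then have "isCont J s"
    by (rule continuous_on_interior) auto
  then have "((\<lambda>t. \<bar>J t - J s\<bar>) \<longlongrightarrow> \<bar>J s - J s\<bar>) (at s)"
    by (intro tendsto_intros) (simp add: isCont_def)
  then have "((\<lambda>t. \<bar>J t - J s\<bar>) \<longlongrightarrow> 0) (at s)"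
    by simp
  moreover have "\<forall>\<^sub>F t in at s. \<bar>J t - J s\<bar> = \<bar>LINT r:{min s t<..<max s t}|lborel. h r\<bar>"
  proof -
    have "\<forall>\<^sub>F t in at s. t \<in> {s - 1<..<s + 1}"
      by (intro eventually_at_in_open') auto
    then show ?thesis
    proof eventually_elim
      case (elim t)
      have J: "J t = (LINT r:{s - 1<..<t}|lborel. h r)" for t
        by (simp add: J_def set_lebesgue_integral_Ioo_eq_integral[OF h])
      show ?case
        using set_integral_Ioo_combine[OF h, of "s - 1" s t]
          set_integral_Ioo_combine[OF h, of "s - 1" t s] elim
        by (cases "s \<le> t") (auto simp: J min_def max_def)
    qed
  qed
  ultimately have "((\<lambda>t. \<bar>LINT r:{min s t<..<max s t}|lborel. h r\<bar>) \<longlongrightarrow> 0) (at s)"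
    by (rule Lim_transform_eventually)
  then show ?thesis by (rule tendsto_rabs_zero_cancel)
qed

lemma set_integral_Ioc_eq_Ioo:
  fixes h :: "real \<Rightarrow> real"
  assumes [measurable]: "h \<in> borel_measurable borel"
  shows "(LINT r:{a<..b}|lborel. h r) = (LINT r:{a<..<b}|lborel. h r)"
  unfolding set_lebesgue_integral_def
proof (rule integral_cong_AE)
  show "AE x in lborel. indicator {a<..b} x *\<^sub>R h x = indicator {a<..<b} x *\<^sub>R h x"
    using AE_lborel_singleton[of b] by eventually_elim (auto simp: indicator_def)
qed auto

text \<open>Half-open intervals are the ones on which \<open>interval_measure\<close> is evaluated;
  bounds along curves use open ones.\<close>

lemma nn_integral_indicator_Ioc:
  fixes h :: "real \<Rightarrow> real"
  assumes h: "integrable lborel h" "\<And>x. 0 \<le> h x"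
  shows "(\<integral>\<^sup>+x. ennreal (h x) * indicator {a<..b} x \<partial>lborel) =
    ennreal (LINT r:{a<..<b}|lborel. h r)"
proof -
  have "h \<in> borel_measurable borel" using h by auto
  have "integrable lborel (\<lambda>x. indicator {a<..b} x *\<^sub>R h x)"
    using set_integrable_lborel_subset[OF h(1), of "{a<..b}"] by (simp add: set_integrable_def)
  from nn_integral_eq_integral[OF this] h(2)
  have "(\<integral>\<^sup>+x. ennreal (indicator {a<..b} x *\<^sub>R h x) \<partial>lborel) = ennreal (LINT r:{a<..b}|lborel. h r)"
    by (simp add: set_lebesgue_integral_def)
  also have "(\<integral>\<^sup>+x. ennreal (indicator {a<..b} x *\<^sub>R h x) \<partial>lborel) =
      (\<integral>\<^sup>+x. ennreal (h x) * indicator {a<..b} x \<partial>lborel)"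
    by (intro nn_integral_cong) (auto simp: indicator_def)
  finally show ?thesis
    by (simp add: set_integral_Ioc_eq_Ioo \<open>h \<in> borel_measurable borel\<close>)
qed

text \<open>Absolute continuity through Stieltjes measures: for an indefinite integral
  \<open>G\<close> of \<open>g\<close>, both \<open>G + f\<close> and \<open>G - f\<close> are
  nondecreasing. The measure of \<open>G + f\<close> is dominated by one with density
  \<open>2 * g\<close>, so it has a density \<open>k\<close>, and \<open>f\<close> is the indefinite
  integral of \<open>k - g\<close>.\<close>

lemma increments_bounded_imp_indefinite_integral:
  fixes f g :: "real \<Rightarrow> real"
  assumes g: "integrable lborel g" "\<And>x. 0 \<le> g x"
    and f: "\<And>s t. s \<le> t \<Longrightarrow> \<bar>f t - f s\<bar> \<le> (LINT r:{s<..<t}|lborel. g r)"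
  obtains h where "integrable lborel h"
    "\<And>s t. s \<le> t \<Longrightarrow> f t - f s = (LINT r:{s<..<t}|lborel. h r)"
proof -
  have gm [measurable]: "g \<in> borel_measurable borel" using g by auto
  define G where "G t = (LINT r:{..t}|lborel. g r)" for t
  have G: "G t - G s = (LINT r:{s<..<t}|lborel. g r)" if "s \<le> t" for s t
  proof -
    have "{..t} = {..s} \<union> {s<..t}" using that by auto
    then have "G t = G s + (LINT r:{s<..t}|lborel. g r)"
      unfolding G_def
      by (simp add: set_integral_Un set_integrable_lborel_subset[OF g(1)] Int_def)
    then show ?thesis by (simp add: set_integral_Ioc_eq_Ioo)
  qed
  \<comment> \<open>Right continuity is required by \<open>interval_measure\<close>. The increments
    of \<open>F1\<close> and \<open>F2\<close> are those of \<open>G\<close> plus or minus those of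
    \<open>f\<close>, hence the factor 2.\<close>
  have cont: "continuous (at_right s) F"
    if F: "\<And>s t. s \<le> t \<Longrightarrow> \<bar>F t - F s\<bar> \<le> 2 * (LINT r:{s<..<t}|lborel. g r)"
    for F :: "real \<Rightarrow> real" and s
  proof -
    have lim: "((\<lambda>t. 2 * (LINT r:{min s t<..<max s t}|lborel. g r)) \<longlongrightarrow> 2 * 0) (at_right s)"
      using set_integral_Ioo_tendsto_0[OF g(1), of s]
      by (intro tendsto_mult tendsto_const) (auto intro: tendsto_within_subset)
    have le: "\<forall>\<^sub>F t in at_right s. norm (F t - F s) \<le> 2 * (LINT r:{min s t<..<max s t}|lborel. g r)"
      unfolding eventually_at_right_field
      using F by (auto simp: min_def max_def intro!: exI[of _ "s + 1"])
    from lim have "((\<lambda>t. F t - F s) \<longlongrightarrow> 0) (at_right s)"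
      by (intro Lim_null_comparison[OF le]) simp
    then show ?thesis
      unfolding continuous_within by (simp add: LIM_zero_iff)
  qed
  define F1 where "F1 t = G t + f t" for t
  define F2 where "F2 t = G t - f t" for t
  have mono: "F1 s \<le> F1 t" "F2 s \<le> F2 t" if "s \<le> t" for s t
    using G[OF that] f[OF that] by (auto simp: F1_def F2_def)
  have c: "continuous (at_right s) F1" "continuous (at_right s) F2" for s
    by (rule cont, use f G in \<open>force simp: F1_def F2_def\<close>)+
  let ?M1 = "interval_measure F1" and ?M2 = "interval_measure F2"
  \<comment> \<open>Since \<open>F1 + F2 = 2 G\<close>, the sum of both measures has density
    \<open>2 * g\<close>. An equality of measures extends from half-open intervals to all Borel
    sets, while an inequality does not extend by that argument; the domination of \<open>?M1\<close>
    is then read off because \<open>?M2\<close> is nonnegative.\<close>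
  define N where "N = measure_of UNIV (sets borel) (\<lambda>A. emeasure ?M1 A + emeasure ?M2 A)"
  define D where "D = density lborel (\<lambda>x. ennreal (2 * g x))"
  have [simp]: "sets N = sets borel" "sets D = sets borel"
    using sets.sigma_sets_eq[of borel] by (auto simp: N_def D_def)
  have N: "emeasure N A = emeasure ?M1 A + emeasure ?M2 A" if "A \<in> sets borel" for A
    unfolding N_def
  proof (rule emeasure_measure_of_sigma)
    show "sigma_algebra UNIV (sets (borel :: real measure))"
      using sets.sigma_algebra_axioms[of borel] by simp
    show "positive (sets borel) (\<lambda>A. emeasure ?M1 A + emeasure ?M2 A)"
      by (auto simp: positive_def)
    show "countably_additive (sets borel) (\<lambda>A. emeasure ?M1 A + emeasure ?M2 A)"
    proof (rule countably_additiveI)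
      fix A :: "nat \<Rightarrow> real set"
      assume "range A \<subseteq> sets borel" "disjoint_family A" "(\<Union>i. A i) \<in> sets borel"
      then show "(\<Sum>i. emeasure ?M1 (A i) + emeasure ?M2 (A i)) =
          emeasure ?M1 (\<Union>i. A i) + emeasure ?M2 (\<Union>i. A i)"
        by (subst suminf_add[symmetric]) (auto simp: suminf_emeasure)
    qed
  qed (use that in auto)
  have "N = D"
  proof (rule measure_eqI_generator_eq)
    let ?E = "range (\<lambda>(a, b). {a<..b::real})"
    show "Int_stable ?E"
      by (auto simp: Int_stable_def greaterThanAtMost_def image_iff) (metis Int_greaterThanAtMost greaterThanAtMost_def)
    show "?E \<subseteq> Pow UNIV" by auto
    show "sets N = sigma_sets UNIV ?E" "sets D = sigma_sets UNIV ?E"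
      by (auto simp: borel_sigma_sets_Ioc)
    show "range (\<lambda>i. {- real i<..real i}) \<subseteq> ?E" by auto
    show "(\<Union>i. {- real i<..real i}) = UNIV" by (rule UN_Ioc_eq_UNIV)
    have E: "emeasure N {a<..b} = ennreal (2 * (LINT r:{a<..<b}|lborel. g r))" for a b
    proof (cases "a \<le> b")
      case True
      then show ?thesis
        using mono[OF True]
        by (simp add: N emeasure_interval_measure_Ioc mono c G[OF True, symmetric]
            ennreal_plus[symmetric] del: ennreal_plus) (simp add: F1_def F2_def algebra_simps)
    qed (simp add: N set_lebesgue_integral_def)
    show "emeasure N {- real i<..real i} \<noteq> \<infinity>" for i
      by (simp add: E)
    fix X assume "X \<in> ?E"
    then obtain a b where X: "X = {a<..b}" by auto
    have "emeasure D X = ennreal (LINT r:{a<..<b}|lborel. 2 * g r)"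
      unfolding D_def X using nn_integral_indicator_Ioc[of "\<lambda>x. 2 * g x"] g
      by (subst emeasure_density) auto
    then show "emeasure N X = emeasure D X" by (simp add: E X)
  qed
  then have le: "emeasure ?M1 A \<le> emeasure D A" if "A \<in> sets borel" for A
    using N[OF that] by simp
  have "absolutely_continuous lborel ?M1"
    unfolding absolutely_continuous_def
  proof
    fix A assume A: "A \<in> null_sets (lborel :: real measure)"
    then have "absolutely_continuous lborel D"
      unfolding D_def by (intro absolutely_continuousI_density) auto
    with A have "emeasure D A = 0" by (auto simp: absolutely_continuous_def)
    with le[of A] A show "A \<in> null_sets ?M1" by (auto simp: null_sets_def)
  qed
  then obtain h1 where h1 [measurable]: "h1 \<in> borel_measurable lborel" and h1_eq: "density lborel h1 = ?M1"
    using sigma_finite_measure.Radon_Nikodym[OF sigma_finite_lborel, of ?M1] by auto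
  have fin: "(\<integral>\<^sup>+x. h1 x \<partial>lborel) < \<infinity>"
  proof -
    have "(\<integral>\<^sup>+x. h1 x \<partial>lborel) = emeasure ?M1 UNIV"
      unfolding h1_eq[symmetric] by (subst emeasure_density) auto
    also have "\<dots> \<le> emeasure D UNIV" by (rule le) simp
    also have "\<dots> = (\<integral>\<^sup>+x. ennreal (2 * g x) \<partial>lborel)"
      unfolding D_def by (subst emeasure_density) auto
    also have "\<dots> < \<infinity>"
      using integrable_mult_right[OF g(1), of 2] g(2)
      unfolding integrable_iff_bounded by (simp add: abs_mult)
    finally show ?thesis .
  qed
  then have h1_fin: "AE x in lborel. h1 x \<noteq> \<infinity>"
    by (intro nn_integral_PInf_AE) auto
  define k where "k x = enn2real (h1 x)" for x
  have k: "integrable lborel k"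
  proof (rule integrableI_bounded)
    show "k \<in> borel_measurable lborel" unfolding k_def by measurable
    have "(\<integral>\<^sup>+x. ennreal (norm (k x)) \<partial>lborel) = (\<integral>\<^sup>+x. h1 x \<partial>lborel)"
      using h1_fin by (intro nn_integral_cong_AE) (auto simp: k_def less_top elim!: eventually_mono)
    with fin show "(\<integral>\<^sup>+x. ennreal (norm (k x)) \<partial>lborel) < \<infinity>" by simp
  qed
  have F1: "F1 t - F1 s = (LINT r:{s<..<t}|lborel. k r)" if "s \<le> t" for s t
  proof -
    have "ennreal (F1 t - F1 s) = emeasure ?M1 {s<..t}"
      using that by (simp add: emeasure_interval_measure_Ioc mono c)
    also have "\<dots> = (\<integral>\<^sup>+x. h1 x * indicator {s<..t} x \<partial>lborel)"
      unfolding h1_eq[symmetric] by (subst emeasure_density) auto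
    also have "\<dots> = (\<integral>\<^sup>+x. ennreal (k x) * indicator {s<..t} x \<partial>lborel)"
      using h1_fin by (intro nn_integral_cong_AE) (auto simp: k_def less_top elim!: eventually_mono)
    also have "\<dots> = ennreal (LINT r:{s<..<t}|lborel. k r)"
      by (intro nn_integral_indicator_Ioc k) (simp add: k_def)
    finally show ?thesis
      using mono[OF that]
      by (subst (asm) ennreal_inj) (auto simp: k_def set_lebesgue_integral_def intro!: integral_nonneg)
  qed
  show thesis
  proof
    show "integrable lborel (\<lambda>r. k r - g r)" using k g by auto
    fix s t :: real assume "s \<le> t"
    then have "f t - f s = (LINT r:{s<..<t}|lborel. k r) - (LINT r:{s<..<t}|lborel. g r)"
      using F1[of s t] G[of s t] by (simp add: F1_def)
    also have "\<dots> = (LINT r:{s<..<t}|lborel. k r - g r)"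
      by (subst set_integral_diff) (auto intro!: set_integrable_lborel_subset k g)
    finally show "f t - f s = (LINT r:{s<..<t}|lborel. k r - g r)" .
  qed
qed

lemma set_integral_mono_real:
  fixes f g :: "real \<Rightarrow> real"
  assumes "integrable lborel f" "integrable lborel g" "A \<in> sets borel" "\<And>x. f x \<le> g x"
  shows "(LINT r:A|lborel. f r) \<le> (LINT r:A|lborel. g r)"
  using assms by (intro set_integral_mono set_integrable_lborel_subset) auto

text \<open>The metric derivative is the supremum of the derivatives of the distances to the points of a
  countable dense subset of the curve.\<close>

lemma metric_derivative_exists:
  fixes d :: "real \<Rightarrow> real \<Rightarrow> real" and g :: "real \<Rightarrow> real"
  assumes sym: "\<And>s t. s \<in> {0..1} \<Longrightarrow> t \<in> {0..1} \<Longrightarrow> d s t = d t s"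
    and tri: "\<And>r s t. r \<in> {0..1} \<Longrightarrow> s \<in> {0..1} \<Longrightarrow> t \<in> {0..1} \<Longrightarrow> d r t \<le> d r s + d s t"
    and g: "set_integrable lborel {0<..<1} g"
    and le: "\<And>s t. 0 \<le> s \<Longrightarrow> s \<le> t \<Longrightarrow> t \<le> 1 \<Longrightarrow> d s t \<le> (LINT r:{s<..<t}|lborel. g r)"
  obtains m where "integrable lborel m" "\<And>t. 0 \<le> m t"
    "\<And>s t. 0 \<le> s \<Longrightarrow> s \<le> t \<Longrightarrow> t \<le> 1 \<Longrightarrow> d s t \<le> (LINT r:{s<..<t}|lborel. m r)"
    "AE t in lborel. t \<in> {0..1} \<longrightarrow>
       ((\<lambda>s. d s t / \<bar>s - t\<bar>) \<longlongrightarrow> m t) (at t within {0..1})"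
proof -
  \<comment> \<open>Extended by zero and made nonnegative, the bound makes sense on the whole
    line.\<close>
  define g0 where "g0 r = \<bar>indicator {0<..<1} r * g r\<bar>" for r
  have g0: "integrable lborel g0" "\<And>x. 0 \<le> g0 x"
    using g by (auto simp: g0_def[abs_def] set_integrable_def)
  have d_le: "d s t \<le> (LINT r:{s<..<t}|lborel. g0 r)" if "0 \<le> s" "s \<le> t" "t \<le> 1" for s t
  proof -
    have "(LINT r:{s<..<t}|lborel. g r) = (LINT r:{s<..<t}|lborel. indicator {0<..<1} r * g r)"
      using that by (intro set_lebesgue_integral_cong) auto
    also have "\<dots> \<le> (LINT r:{s<..<t}|lborel. g0 r)"
      using g g0(1) by (intro set_integral_mono_real) (auto simp: set_integrable_def g0_def)
    finally show ?thesis using le[OF that] by simp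
  qed
  have d_refl: "d s s \<le> 0" if "s \<in> {0..1}" for s
    using d_le[of s s] that by (simp add: set_lebesgue_integral_def)
  have d_nonneg: "0 \<le> d s t" if "s \<in> {0..1}" "t \<in> {0..1}" for s t
    using tri[of t s t] tri[of t t s] sym[OF that] tri[of t t t] that by force
  \<comment> \<open>The curve is frozen outside the unit interval. This keeps the increment bound,
    because \<open>g0\<close> vanishes there, and gives distance functions on the whole
    line.\<close>
  define cl :: "real \<Rightarrow> real" where "cl t = max 0 (min 1 t)" for t
  have cl: "cl t \<in> {0..1}" for t by (auto simp: cl_def)
  have cl_id [simp]: "cl t = t" if "t \<in> {0..1}" for t using that by (auto simp: cl_def)
  have d_cl: "d (cl s) (cl t) \<le> (LINT r:{s<..<t}|lborel. g0 r)" if "s \<le> t" for s t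
  proof -
    have "d (cl s) (cl t) \<le> (LINT r:{cl s<..<cl t}|lborel. g0 r)"
      using that by (intro d_le) (auto simp: cl_def)
    also have "\<dots> = (LINT r:{s<..<t}|lborel. g0 r)"
      unfolding set_lebesgue_integral_def
      by (intro Bochner_Integration.integral_cong)
        (auto simp: indicator_def g0_def cl_def split: if_splits)
    finally show ?thesis .
  qed
  \<comment> \<open>Density in the parameter is enough: by continuity of the integral of
    \<open>g0\<close>, nearby parameters give points that are close in \<open>d\<close>.\<close>
  define Q :: "real set" where "Q = \<rat> \<inter> {0..1}"
  have Q: "countable Q" "Q \<noteq> {}" "Q \<subseteq> {0..1}"
    unfolding Q_def using countable_rat by (auto intro!: countable_Int1 exI[of _ 0])
  have "\<exists>h. integrable lborel h \<and>
    (\<forall>s t. s \<le> t \<longrightarrow> d q (cl t) - d q (cl s) = (LINT r:{s<..<t}|lborel. h r))" if "q \<in> Q" for q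
  proof -
    have "\<bar>d q (cl t) - d q (cl s)\<bar> \<le> (LINT r:{s<..<t}|lborel. g0 r)" if "s \<le> t" for s t
      using d_cl[OF that] tri[of q "cl s" "cl t"] tri[of q "cl t" "cl s"] sym[OF cl cl, of s t]
        cl[of s] cl[of t] \<open>q \<in> Q\<close> Q by (auto simp: abs_le_iff subset_iff)
    from increments_bounded_imp_indefinite_integral[OF g0 this] show ?thesis by metis
  qed
  then obtain H where H: "\<And>q. q \<in> Q \<Longrightarrow> integrable lborel (H q)"
    "\<And>q s t. q \<in> Q \<Longrightarrow> s \<le> t \<Longrightarrow> d q (cl t) - d q (cl s) = (LINT r:{s<..<t}|lborel. H q r)"
    by metis
  let ?avg = "\<lambda>h t s. (LINT r:{min s t<..<max s t}|lborel. h r) / \<bar>s - t\<bar> :: real"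
  have avgH: "\<bar>?avg (H q) t s\<bar> = \<bar>d q (cl t) - d q (cl s)\<bar> / \<bar>s - t\<bar>" if "q \<in> Q" for q s t
    using H(2)[OF that, of s t] H(2)[OF that, of t s] by (cases "s \<le> t") (auto simp: min_def max_def)
  have diffH: "\<bar>d q (cl t) - d q (cl s)\<bar> \<le> d (cl s) (cl t)" if "q \<in> Q" for q s t
    using tri[of q "cl s" "cl t"] tri[of q "cl t" "cl s"] sym[OF cl cl, of s t]
        cl[of s] cl[of t] that Q by (auto simp: abs_le_iff subset_iff)
  have lebH: "AE t in lborel. \<forall>q\<in>Q. (?avg (H q) t \<longlongrightarrow> H q t) (at t)"
    using AE_average_tendsto[OF H(1)] by (simp add: AE_ball_countable Q)
  have H_le: "AE t in lborel. \<forall>q\<in>Q. \<bar>H q t\<bar> \<le> g0 t"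
    using lebH AE_average_tendsto[OF g0(1)]
  proof eventually_elim
    case (elim t)
    show ?case
    proof
      fix q assume q: "q \<in> Q"
      have "\<bar>?avg (H q) t s\<bar> \<le> ?avg g0 t s" for s
        unfolding avgH[OF q] using diffH[OF q, of t s] d_cl[of s t] d_cl[of t s] sym[OF cl cl, of s t]
        by (intro divide_right_mono) (auto simp: min_def max_def)
      then show "\<bar>H q t\<bar> \<le> g0 t"
        by (intro tendsto_le[OF _ elim(2) tendsto_rabs[OF bspec[OF elim(1) q]]] always_eventually) auto
    qed
  qed
  \<comment> \<open>Truncation at \<open>g0\<close> bounds the family for every \<open>t\<close>, so
    that the real supremum is meaningful everywhere; by \<open>H_le\<close> it changes nothing for
    almost every \<open>t\<close>.\<close>
  define k where "k q t = min \<bar>H q t\<bar> (g0 t)" for q t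
  define m where "m t = (SUP q\<in>Q. k q t)" for t
  have bdd: "bdd_above ((\<lambda>q. k q t) ` Q)" for t
    by (auto simp: k_def intro!: bdd_aboveI[of _ "g0 t"])
  have k_le: "k q t \<le> m t" if "q \<in> Q" for q t
    unfolding m_def using that by (intro cSUP_upper bdd)
  have m_le: "m t \<le> g0 t" for t
    unfolding m_def using Q by (intro cSUP_least) (auto simp: k_def)
  have m_nonneg: "0 \<le> m t" for t
  proof -
    obtain q where "q \<in> Q" using Q by auto
    from k_le[OF this, of t] show ?thesis
      using g0(2)[of t] by (simp add: k_def min_def split: if_splits)
  qed
  have m_meas: "m \<in> borel_measurable lborel"
    unfolding m_def k_def using Q H(1) g0(1) bdd[unfolded k_def]
    by (intro borel_measurable_cSUP borel_measurable_min borel_measurable_abs)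
      (auto dest: borel_measurable_integrable)
  have m: "integrable lborel m"
    by (rule Bochner_Integration.integrable_bound[OF g0(1) m_meas])
      (use m_le m_nonneg g0(2) in auto)
  \<comment> \<open>For \<open>q\<close> near \<open>s\<close> the distance from \<open>q\<close>
    grows along the curve by at most the integral of \<open>m\<close>. Replacing \<open>q\<close> by
    \<open>s\<close> costs \<open>d q s\<close> twice, hence the choice of
    \<open>e / 2\<close>.\<close>
  have d_m: "d s t \<le> (LINT r:{s<..<t}|lborel. m r)" if st: "0 \<le> s" "s \<le> t" "t \<le> 1" for s t
  proof (rule field_le_epsilon)
    fix e :: real assume "e > 0"
    have "\<forall>\<^sub>F q in at s. (LINT r:{min s q<..<max s q}|lborel. g0 r) < e / 2"
      using set_integral_Ioo_tendsto_0[OF g0(1), of s] \<open>e > 0\<close> by (auto dest: order_tendstoD(2)[of _ _ _ "e / 2"])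
    then obtain \<delta> where \<delta>: "\<delta> > 0"
      "\<And>q. q \<noteq> s \<Longrightarrow> dist q s < \<delta> \<Longrightarrow> (LINT r:{min s q<..<max s q}|lborel. g0 r) < e / 2"
      by (auto simp: eventually_at)
    have "\<exists>q\<in>Q. \<bar>q - s\<bar> < \<delta>"
    proof (cases "s < 1")
      case True
      then obtain q where "q \<in> \<rat>" "s < q" "q < min 1 (s + \<delta>)"
        using Rats_dense_in_real[of s "min 1 (s + \<delta>)"] \<delta>(1) by auto
      then show ?thesis using st by (intro bexI[of _ q]) (auto simp: Q_def)
    next
      case False
      then show ?thesis using st \<delta>(1) by (intro bexI[of _ 1]) (auto simp: Q_def)
    qed
    then obtain q where q: "q \<in> Q" "\<bar>q - s\<bar> < \<delta>" by auto
    have dqs: "d q s \<le> e / 2"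
    proof (cases "q = s")
      case True
      then show ?thesis using d_refl[of s] st \<open>e > 0\<close> by simp
    next
      case False
      then have "(LINT r:{min s q<..<max s q}|lborel. g0 r) < e / 2"
        using \<delta>(2)[of q] q by (simp add: dist_real_def)
      then show ?thesis
        using d_le[of q s] d_le[of s q] sym[of q s] q(1) Q(3) st
        by (cases "q \<le> s") (auto simp: min_absorb1 min_absorb2 max_absorb1 max_absorb2 subset_iff)
    qed
    have "d q t - d q s = (LINT r:{s<..<t}|lborel. H q r)"
      using H(2)[OF q(1), of s t] st by simp
    also have "\<dots> \<le> (LINT r:{s<..<t}|lborel. \<bar>H q r\<bar>)"
      using H(1)[OF q(1)] by (intro set_integral_mono_real) auto
    also have "\<dots> \<le> (LINT r:{s<..<t}|lborel. m r)"
    proof -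
      have "AE r in lborel. \<bar>H q r\<bar> \<le> m r"
        using H_le
      proof eventually_elim
        case (elim r)
        with q(1) have "k q r = \<bar>H q r\<bar>" by (simp add: k_def)
        with k_le[OF q(1), of r] show ?case by simp
      qed
      then show ?thesis
        unfolding set_lebesgue_integral_def
        using set_integrable_lborel_subset[OF m, of "{s<..<t}"]
          set_integrable_lborel_subset[OF integrable_abs[OF H(1)[OF q(1)]], of "{s<..<t}"]
        by (intro integral_mono_AE) (auto simp: set_integrable_def indicator_def elim!: eventually_mono)
    qed
    finally have "d q t - d q s \<le> (LINT r:{s<..<t}|lborel. m r)" .
    moreover have "d s t \<le> d q s + d q t"
      using tri[of s q t] sym[of s q] q(1) Q(3) st by auto
    ultimately show "d s t \<le> (LINT r:{s<..<t}|lborel. m r) + e"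
      using dqs by simp
  qed
  have "AE t in lborel. t \<in> {0..1} \<longrightarrow>
       ((\<lambda>s. d s t / \<bar>s - t\<bar>) \<longlongrightarrow> m t) (at t within {0..1})"
    using lebH H_le AE_average_tendsto[OF m]
  proof eventually_elim
    case (elim t)
    show ?case
    proof (intro impI order_tendstoI)
      assume t: "t \<in> {0..1}"
      have in01: "\<forall>\<^sub>F s in at t within {0..1}. s \<in> {0..1}"
        by (auto simp: eventually_at_filter)
      \<comment> \<open>Lower bound: some \<open>q\<close> nearly attains the supremum, and the
        distance from \<open>q\<close> is 1-Lipschitz, so its difference quotients lie below those
        of the curve.\<close>
      { fix a assume "a < m t"
        then obtain q where q: "q \<in> Q" "a < k q t"
          unfolding m_def using less_cSUP_iff[OF Q(2) bdd] by auto
        with elim(2) have "a < \<bar>H q t\<bar>" by (auto simp: k_def)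
        moreover have "((\<lambda>s. \<bar>?avg (H q) t s\<bar>) \<longlongrightarrow> \<bar>H q t\<bar>) (at t within {0..1})"
          using elim(1) q(1) by (intro tendsto_rabs) (auto intro: tendsto_within_subset)
        ultimately have "\<forall>\<^sub>F s in at t within {0..1}. a < \<bar>?avg (H q) t s\<bar>"
          by (intro order_tendstoD(1))
        then show "\<forall>\<^sub>F s in at t within {0..1}. a < d s t / \<bar>s - t\<bar>"
          using in01
        proof eventually_elim
          case (elim s)
          have "\<bar>?avg (H q) t s\<bar> \<le> d s t / \<bar>s - t\<bar>"
            unfolding avgH[OF q(1)] using diffH[OF q(1), of t s] t elim(2)
            by (intro divide_right_mono) auto
          then show ?case using elim by linarith
        qed
      next
        \<comment> \<open>Upper bound: by \<open>d_m\<close> the quotients are at most averages of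
          \<open>m\<close>, and \<open>t\<close> is a point where these converge to
          \<open>m t\<close>.\<close>
        fix a assume "m t < a"
        have "(?avg m t \<longlongrightarrow> m t) (at t within {0..1})"
          using elim(3) by (rule tendsto_within_subset) auto
        with \<open>m t < a\<close> have "\<forall>\<^sub>F s in at t within {0..1}. ?avg m t s < a"
          by (intro order_tendstoD(2))
        then show "\<forall>\<^sub>F s in at t within {0..1}. d s t / \<bar>s - t\<bar> < a"
          using in01
        proof eventually_elim
          case (elim s)
          have "d s t / \<bar>s - t\<bar> \<le> ?avg m t s"
            using d_m[of s t] d_m[of t s] sym[of s t] t elim(2)
            by (intro divide_right_mono) (auto simp: min_def max_def)
          then show ?case using elim by linarith
        qed
      }
    qed
  qed
  with m m_nonneg d_m show thesis by (rule that)
qed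

section \<open>The Wasserstein distance on the line\<close>

text \<open>Minkowski's inequality by weights: \<open>(u + v)^2\<close> is at most
  \<open>(1 + q/p) u^2 + (1 + p/q) v^2\<close>, and for norms p and q the right side integrates to
  \<open>(p + q)^2\<close>. Adding \<open>e\<close> to both bounds keeps the weights defined when
  \<open>a\<close> or \<open>b\<close> is 0; then \<open>e\<close> tends to 0.\<close>

lemma nn_integral_L2_triangle:
  fixes f g :: "'a \<Rightarrow> real"
  assumes [measurable]: "f \<in> borel_measurable M" "g \<in> borel_measurable M"
    and f: "(\<integral>\<^sup>+x. ennreal ((f x)\<^sup>2) \<partial>M) \<le> ennreal (a\<^sup>2)"
    and g: "(\<integral>\<^sup>+x. ennreal ((g x)\<^sup>2) \<partial>M) \<le> ennreal (b\<^sup>2)"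
    and ab: "0 \<le> a" "0 \<le> b"
  shows "(\<integral>\<^sup>+x. ennreal ((f x + g x)\<^sup>2) \<partial>M) \<le> ennreal ((a + b)\<^sup>2)"
proof -
  have le: "(\<integral>\<^sup>+x. ennreal ((f x + g x)\<^sup>2) \<partial>M) \<le> ennreal ((a + e + (b + e))\<^sup>2)" if "e > 0" for e
  proof -
    define p where "p = a + e" define q where "q = b + e"
    have pq: "p > 0" "q > 0" using ab that by (auto simp: p_def q_def)
    have "(u + v)\<^sup>2 \<le> (1 + q / p) * u\<^sup>2 + (1 + p / q) * v\<^sup>2" for u v
    proof -
      have "(1 + q / p) * u\<^sup>2 + (1 + p / q) * v\<^sup>2 - (u + v)\<^sup>2 = (q * u - p * v)\<^sup>2 / (p * q)"
        using pq by (simp add: field_simps power2_eq_square)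
      also have "\<dots> \<ge> 0" using pq by simp
      finally show ?thesis by simp
    qed
    then have "(\<integral>\<^sup>+x. ennreal ((f x + g x)\<^sup>2) \<partial>M) \<le>
        (\<integral>\<^sup>+x. ennreal (1 + q / p) * ennreal ((f x)\<^sup>2) + ennreal (1 + p / q) * ennreal ((g x)\<^sup>2) \<partial>M)"
      using pq by (intro nn_integral_mono)
        (simp add: ennreal_mult[symmetric] ennreal_plus[symmetric] del: ennreal_plus)
    also have "\<dots> = ennreal (1 + q / p) * (\<integral>\<^sup>+x. ennreal ((f x)\<^sup>2) \<partial>M) +
        ennreal (1 + p / q) * (\<integral>\<^sup>+x. ennreal ((g x)\<^sup>2) \<partial>M)"
      by (simp add: nn_integral_add nn_integral_cmult)
    also have "\<dots> \<le> ennreal (1 + q / p) * ennreal (p\<^sup>2) + ennreal (1 + p / q) * ennreal (q\<^sup>2)"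
      using ab that by (intro add_mono mult_left_mono order_trans[OF f] order_trans[OF g] ennreal_leI)
        (auto simp: p_def q_def power_mono)
    also have "\<dots> = ennreal ((1 + q / p) * p\<^sup>2 + (1 + p / q) * q\<^sup>2)"
      using pq by (simp add: ennreal_mult[symmetric] ennreal_plus[symmetric] del: ennreal_plus)
    also have "(1 + q / p) * p\<^sup>2 + (1 + p / q) * q\<^sup>2 = (p + q)\<^sup>2"
      using pq by (simp add: field_simps power2_eq_square)
    finally show ?thesis by (simp add: p_def q_def)
  qed
  have "((\<lambda>e. ennreal ((a + e + (b + e))\<^sup>2)) \<longlongrightarrow> ennreal ((a + 0 + (b + 0))\<^sup>2)) (at_right 0)"
    by (intro tendsto_intros)
  then have "(\<integral>\<^sup>+x. ennreal ((f x + g x)\<^sup>2) \<partial>M) \<le> ennreal ((a + 0 + (b + 0))\<^sup>2)"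
    by (rule tendsto_lowerbound)
      (use le in \<open>auto simp: eventually_at_right_field simp del: ennreal_le_iff intro!: exI[of _ 1]\<close>)
  then show ?thesis by simp
qed

section \<open>Basic facts on couplings and the quadratic distance\<close>

lemma P2_D:
  assumes "\<mu> \<in> P2"
  shows "sets \<mu> = sets borel" "prob_space \<mu>" "space \<mu> = UNIV"
  using assms sets_eq_imp_space_eq[of \<mu> borel] by (auto simp: P2_def)

lemma coupling_D:
  assumes "\<gamma> \<in> couplings \<mu> \<nu>" "prob_space \<mu>"
  shows "sets \<gamma> = sets (borel \<Otimes>\<^sub>M borel)" "prob_space \<gamma>" "space \<gamma> = UNIV"
    "distr \<gamma> borel fst = \<mu>" "distr \<gamma> borel snd = \<nu>"
    "fst \<in> measurable \<gamma> borel" "snd \<in> measurable \<gamma> borel"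
proof -
  show s: "sets \<gamma> = sets (borel \<Otimes>\<^sub>M borel)" and d: "distr \<gamma> borel fst = \<mu>" "distr \<gamma> borel snd = \<nu>"
    using assms(1) by (auto simp: couplings_def)
  note [measurable_cong] = s
  show m: "fst \<in> measurable \<gamma> borel" "snd \<in> measurable \<gamma> borel" by measurable
  show "space \<gamma> = UNIV" using sets_eq_imp_space_eq[OF s] by (simp add: space_pair_measure)
  interpret \<mu>: prob_space \<mu> by fact
  show "prob_space \<gamma>"
    using \<mu>.emeasure_space_1 m unfolding d(1)[symmetric]
    by (intro prob_spaceI) (simp add: emeasure_distr)
qed

lemma W_nonneg: "0 \<le> W \<mu> \<nu>"
  by (simp add: W_def)

lemma ennreal_W_power2:
  assumes "\<mu> \<in> P2" "\<nu> \<in> P2"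
  shows "ennreal ((W \<mu> \<nu>)\<^sup>2) =
    (INF \<gamma>\<in>couplings \<mu> \<nu>. \<integral>\<^sup>+ z. ennreal ((dist (fst z) (snd z))\<^sup>2) \<partial>\<gamma>)"
  using W_INF_finite[OF assms] by (simp add: W_def)

lemma ennreal_W_power2_le:
  assumes "\<mu> \<in> P2" "\<nu> \<in> P2" "\<gamma> \<in> couplings \<mu> \<nu>"
  shows "ennreal ((W \<mu> \<nu>)\<^sup>2) \<le> (\<integral>\<^sup>+ z. ennreal ((dist (fst z) (snd z))\<^sup>2) \<partial>\<gamma>)"
  unfolding ennreal_W_power2[OF assms(1,2)] by (rule INF_lower[OF assms(3)])

lemma emeasure_lborel_square:
  fixes x y :: real
  shows "(\<integral>\<^sup>+p. indicator {p. x \<le> min (fst p) (snd p) \<and> max (fst p) (snd p) < y} p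
      \<partial>(lborel \<Otimes>\<^sub>M lborel)) = ennreal ((max 0 (y - x))\<^sup>2)"
proof -
  have "{p. x \<le> min (fst p) (snd p) \<and> max (fst p) (snd p) < y} = {x..<y} \<times> {x..<y}"
    by auto
  then show ?thesis
    by (cases "x \<le> y")
      (auto simp: lborel.emeasure_pair_measure_Times ennreal_mult[symmetric] power2_eq_square max_def)
qed

lemma sets_Collect_borel_pair:
  assumes "Measurable.pred (borel \<Otimes>\<^sub>M borel) P"
  shows "Collect P \<in> sets (borel \<Otimes>\<^sub>M borel)"
  using assms by (simp add: pred_def space_pair_measure)

text \<open>Since \<open>(x - y)\<^sup>2\<close> is the area of a square, the cost of a coupling of two measures on the line is
  an integral of the masses that it gives to quadrants. The quantile coupling minimises all of them
  at once.\<close>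

lemma nn_integral_dist_power2_real:
  fixes \<gamma> :: "(real \<times> real) measure"
  assumes sets_\<gamma> [measurable_cong]: "sets \<gamma> = sets (borel \<Otimes>\<^sub>M borel)" and "prob_space \<gamma>"
  shows "(\<integral>\<^sup>+z. ennreal ((dist (fst z) (snd z))\<^sup>2) \<partial>\<gamma>) =
    (\<integral>\<^sup>+p. emeasure \<gamma> {z. fst z \<le> min (fst p) (snd p) \<and> max (fst p) (snd p) < snd z} +
           emeasure \<gamma> {z. snd z \<le> min (fst p) (snd p) \<and> max (fst p) (snd p) < fst z}
      \<partial>(lborel \<Otimes>\<^sub>M lborel))"
proof -
  interpret \<gamma>: prob_space \<gamma> by fact
  interpret L: pair_sigma_finite lborel "lborel :: real measure" ..
  interpret P: pair_sigma_finite \<gamma> "lborel \<Otimes>\<^sub>M lborel :: (real \<times> real) measure" ..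
  have sp [simp]: "space \<gamma> = UNIV"
    using sets_eq_imp_space_eq[OF sets_\<gamma>] by (simp add: space_pair_measure)
  let ?A = "\<lambda>z p. fst z \<le> min (fst p) (snd p) \<and> max (fst p) (snd p) < (snd z :: real)"
  let ?B = "\<lambda>z p. snd z \<le> min (fst p) (snd p) \<and> max (fst p) (snd p) < (fst z :: real)"
  have "(\<integral>\<^sup>+z. ennreal ((dist (fst z) (snd z))\<^sup>2) \<partial>\<gamma>) =
    (\<integral>\<^sup>+z. (\<integral>\<^sup>+p. indicator {p. ?A z p} p + indicator {p. ?B z p} p \<partial>(lborel \<Otimes>\<^sub>M lborel)) \<partial>\<gamma>)"
  proof (intro nn_integral_cong)
    fix z :: "real \<times> real"
    have "(\<integral>\<^sup>+p. indicator {p. ?A z p} p + indicator {p. ?B z p} p \<partial>(lborel \<Otimes>\<^sub>M lborel)) =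
       ennreal ((max 0 (snd z - fst z))\<^sup>2) + ennreal ((max 0 (fst z - snd z))\<^sup>2)"
      by (subst nn_integral_add) (simp_all only: emeasure_lborel_square, measurable)
    also have "\<dots> = ennreal ((dist (fst z) (snd z))\<^sup>2)"
      by (simp add: max_def dist_real_def power2_commute)
    finally show "ennreal ((dist (fst z) (snd z))\<^sup>2) =
      (\<integral>\<^sup>+p. indicator {p. ?A z p} p + indicator {p. ?B z p} p \<partial>(lborel \<Otimes>\<^sub>M lborel))" ..
  qed
  also have "\<dots> = (\<integral>\<^sup>+p. (\<integral>\<^sup>+z. indicator {p. ?A z p} p + indicator {p. ?B z p} p \<partial>\<gamma>) \<partial>(lborel \<Otimes>\<^sub>M lborel))"
    by (subst P.Fubini') (auto simp: split_beta')
  also have "\<dots> = (\<integral>\<^sup>+p. emeasure \<gamma> {z. ?A z p} + emeasure \<gamma> {z. ?B z p} \<partial>(lborel \<Otimes>\<^sub>M lborel))"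
  proof (intro nn_integral_cong)
    fix p :: "real \<times> real"
    have AB [measurable]: "{z. ?A z p} \<in> sets \<gamma>" "{z. ?B z p} \<in> sets \<gamma>"
      unfolding sets_\<gamma> by (rule sets_Collect_borel_pair, measurable)+
    have "(\<integral>\<^sup>+z. indicator {p. ?A z p} p + indicator {p. ?B z p} p \<partial>\<gamma>) =
        (\<integral>\<^sup>+z. indicator {z. ?A z p} z + indicator {z. ?B z p} z \<partial>\<gamma>)"
      by (intro nn_integral_cong) (auto simp: indicator_def)
    also have "\<dots> = emeasure \<gamma> {z. ?A z p} + emeasure \<gamma> {z. ?B z p}"
      by (subst nn_integral_add) (simp_all only: nn_integral_indicator AB, measurable)
    finally show "(\<integral>\<^sup>+z. indicator {p. ?A z p} p + indicator {p. ?B z p} p \<partial>\<gamma>) =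
      emeasure \<gamma> {z. ?A z p} + emeasure \<gamma> {z. ?B z p}" .
  qed
  finally show ?thesis .
qed

text \<open>Only arguments strictly between 0 and 1 matter; for a probability measure the set is
  then nonempty and bounded below.\<close>

definition quantile :: "real measure \<Rightarrow> real \<Rightarrow> real" where
  "quantile \<alpha> u = Inf {x. u \<le> cdf \<alpha> x}"

abbreviation unif01 :: "real measure" where
  "unif01 \<equiv> restrict_space lborel {0<..<1}"

lemma P2_imp_cdf_distribution:
  assumes "\<alpha> \<in> P2"
  shows "cdf_distribution \<alpha>"
proof -
  interpret prob_space \<alpha> using P2_D[OF assms] by simp
  show ?thesis
    using P2_D[OF assms] by unfold_locales auto
qed

lemma measurable_quantile:
  assumes "\<alpha> \<in> P2"
  shows "quantile \<alpha> \<in> borel_measurable unif01"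
proof -
  interpret cdf_distribution \<alpha> by (rule P2_imp_cdf_distribution[OF assms])
  have "sets unif01 = sets (restrict_space borel {0<..<1::real})"
    by (simp add: sets_restrict_space)
  then show ?thesis
    using measurable_CI unfolding quantile_def[abs_def] by (simp cong: measurable_cong_sets)
qed

lemma quantile_le_iff:
  assumes "\<alpha> \<in> P2" "0 < u" "u < 1"
  shows "quantile \<alpha> u \<le> x \<longleftrightarrow> u \<le> cdf \<alpha> x"
proof -
  interpret cdf_distribution \<alpha> by (rule P2_imp_cdf_distribution[OF assms(1)])
  show ?thesis using pseudoinverse[OF assms(2,3), of x] by (simp add: quantile_def)
qed

lemma distr_quantile:
  assumes "\<alpha> \<in> P2"
  shows "distr unif01 borel (quantile \<alpha>) = \<alpha>"
proof -
  interpret cdf_distribution \<alpha> by (rule P2_imp_cdf_distribution[OF assms])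
  show ?thesis using distr_I_eq_M by (simp add: quantile_def[abs_def])
qed

definition quantile_coupling :: "real measure \<Rightarrow> real measure \<Rightarrow> (real \<times> real) measure" where
  "quantile_coupling \<alpha> \<beta> = distr unif01 (borel \<Otimes>\<^sub>M borel) (\<lambda>u. (quantile \<alpha> u, quantile \<beta> u))"

lemma quantile_coupling:
  assumes "\<alpha> \<in> P2" "\<beta> \<in> P2"
  shows "quantile_coupling \<alpha> \<beta> \<in> couplings \<alpha> \<beta>"
proof -
  note [measurable] = measurable_quantile[OF assms(1)] measurable_quantile[OF assms(2)]
  show ?thesis
    using distr_quantile[OF assms(1)] distr_quantile[OF assms(2)]
    by (auto simp: couplings_def quantile_coupling_def distr_distr comp_def)
qed

text \<open>By the Galois property of quantiles the first event says that \<open>u\<close> lies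
  above \<open>cdf \<beta> b\<close> and not above \<open>cdf \<alpha> a\<close>, an interval whose
  length is the difference. \<open>ennreal\<close> sends a negative difference to 0, which is the
  case of an empty interval.\<close>

lemma emeasure_quantile_coupling_quadrant_le:
  assumes P: "\<alpha> \<in> P2" "\<beta> \<in> P2"
  shows "emeasure (quantile_coupling \<alpha> \<beta>) {z. fst z \<le> a \<and> b < snd z} \<le> ennreal (cdf \<alpha> a - cdf \<beta> b)"
    and "emeasure (quantile_coupling \<alpha> \<beta>) {z. snd z \<le> a \<and> b < fst z} \<le> ennreal (cdf \<beta> a - cdf \<alpha> b)"
proof -
  note [measurable] = measurable_quantile[OF P(1)] measurable_quantile[OF P(2)]
  have sub: "emeasure unif01 A \<le> ennreal (y - x)" if "A \<subseteq> {x<..y}" "A \<subseteq> {0<..<1}" for x y :: real and A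
  proof -
    have "emeasure unif01 A = emeasure lborel A"
      using that by (simp add: emeasure_restrict_space)
    also have "\<dots> \<le> emeasure lborel {x<..y}"
      using that(1) by (rule emeasure_mono) simp
    also have "\<dots> \<le> ennreal (y - x)"
      by (cases "x \<le> y") auto
    finally show ?thesis .
  qed
  have m: "{z. fst z \<le> a \<and> b < snd z} \<in> sets (borel \<Otimes>\<^sub>M borel)"
    "{z. snd z \<le> a \<and> b < fst z} \<in> sets (borel \<Otimes>\<^sub>M borel)" for a b :: real
    by (rule sets_Collect_borel_pair, measurable)+
  show "emeasure (quantile_coupling \<alpha> \<beta>) {z. fst z \<le> a \<and> b < snd z} \<le> ennreal (cdf \<alpha> a - cdf \<beta> b)"
    unfolding quantile_coupling_def
    by (subst emeasure_distr, simp, rule m, rule sub)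
      (auto simp: space_restrict_space quantile_le_iff[OF P(1)] quantile_le_iff[OF P(2)] not_le[symmetric])
  show "emeasure (quantile_coupling \<alpha> \<beta>) {z. snd z \<le> a \<and> b < fst z} \<le> ennreal (cdf \<beta> a - cdf \<alpha> b)"
    unfolding quantile_coupling_def
    by (subst emeasure_distr, simp, rule m, rule sub)
      (auto simp: space_restrict_space quantile_le_iff[OF P(1)] quantile_le_iff[OF P(2)] not_le[symmetric])
qed

text \<open>Mass starting at or below \<open>a\<close> either ends above \<open>b\<close> or is part
  of the mass that \<open>\<beta>\<close> gives to points not above \<open>b\<close>.\<close>

lemma emeasure_coupling_quadrant_ge:
  assumes P: "\<alpha> \<in> P2" "\<beta> \<in> P2" and \<gamma>: "\<gamma> \<in> couplings \<alpha> \<beta>"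
  shows "ennreal (cdf \<alpha> a - cdf \<beta> b) \<le> emeasure \<gamma> {z. fst z \<le> a \<and> b < snd z}"
    and "ennreal (cdf \<beta> a - cdf \<alpha> b) \<le> emeasure \<gamma> {z. snd z \<le> a \<and> b < fst z}"
proof -
  note D = coupling_D[OF \<gamma> P2_D(2)[OF P(1)]]
  note [measurable_cong] = D(1)
  interpret \<gamma>: prob_space \<gamma> by (rule D)
  have cdf: "cdf \<alpha> x = measure \<gamma> {z. fst z \<le> x}" "cdf \<beta> x = measure \<gamma> {z. snd z \<le> x}" for x
    unfolding cdf_def D(4)[symmetric] D(5)[symmetric] using D(3,6,7)
    by (auto simp: measure_distr intro!: arg_cong[where f="measure \<gamma>"])
  have ms [measurable]: "{z. fst z \<le> x} \<in> sets \<gamma>" "{z. snd z \<le> x} \<in> sets \<gamma>"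
    "{z. x < fst z} \<in> sets \<gamma>" "{z. x < snd z} \<in> sets \<gamma>" for x
    unfolding D(1) by (rule sets_Collect_borel_pair, measurable)+
  have "measure \<gamma> {z. fst z \<le> a} \<le> measure \<gamma> ({z. fst z \<le> a} \<inter> {z. b < snd z} \<union> {z. snd z \<le> b})"
    by (intro \<gamma>.finite_measure_mono sets.Un sets.Int ms) auto
  also have "\<dots> \<le> measure \<gamma> ({z. fst z \<le> a} \<inter> {z. b < snd z}) + measure \<gamma> {z. snd z \<le> b}"
    by (intro measure_Un_le sets.Int ms)
  finally show "ennreal (cdf \<alpha> a - cdf \<beta> b) \<le> emeasure \<gamma> {z. fst z \<le> a \<and> b < snd z}"
    by (simp add: cdf \<gamma>.emeasure_eq_measure Collect_conj_eq ennreal_leI)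
  have "measure \<gamma> {z. snd z \<le> a} \<le> measure \<gamma> ({z. snd z \<le> a} \<inter> {z. b < fst z} \<union> {z. fst z \<le> b})"
    by (intro \<gamma>.finite_measure_mono sets.Un sets.Int ms) auto
  also have "\<dots> \<le> measure \<gamma> ({z. snd z \<le> a} \<inter> {z. b < fst z}) + measure \<gamma> {z. fst z \<le> b}"
    by (intro measure_Un_le sets.Int ms)
  finally show "ennreal (cdf \<beta> a - cdf \<alpha> b) \<le> emeasure \<gamma> {z. snd z \<le> a \<and> b < fst z}"
    by (simp add: cdf \<gamma>.emeasure_eq_measure Collect_conj_eq ennreal_leI)
qed

text \<open>The two quadrant bounds meet at the positive part of a difference of distribution
  functions, so the quantile coupling minimises the integrand of the cost formula pointwise.\<close>

lemma W_real_eq_quantile: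
  assumes P: "\<alpha> \<in> P2" "\<beta> \<in> P2"
  shows "ennreal ((W \<alpha> \<beta>)\<^sup>2) = (\<integral>\<^sup>+u. ennreal ((quantile \<alpha> u - quantile \<beta> u)\<^sup>2) \<partial>unif01)"
proof -
  note [measurable] = measurable_quantile[OF P(1)] measurable_quantile[OF P(2)]
  let ?q = "quantile_coupling \<alpha> \<beta>"
  note q = quantile_coupling[OF P]
  have "ennreal ((W \<alpha> \<beta>)\<^sup>2) = (\<integral>\<^sup>+z. ennreal ((dist (fst z) (snd z))\<^sup>2) \<partial>?q)"
  proof (rule antisym)
    show "ennreal ((W \<alpha> \<beta>)\<^sup>2) \<le> (\<integral>\<^sup>+z. ennreal ((dist (fst z) (snd z))\<^sup>2) \<partial>?q)"
      by (rule ennreal_W_power2_le[OF P q])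
    show "(\<integral>\<^sup>+z. ennreal ((dist (fst z) (snd z))\<^sup>2) \<partial>?q) \<le> ennreal ((W \<alpha> \<beta>)\<^sup>2)"
      unfolding ennreal_W_power2[OF P]
    proof (rule INF_greatest)
      fix \<gamma> assume \<gamma>: "\<gamma> \<in> couplings \<alpha> \<beta>"
      show "(\<integral>\<^sup>+z. ennreal ((dist (fst z) (snd z))\<^sup>2) \<partial>?q) \<le>
          (\<integral>\<^sup>+z. ennreal ((dist (fst z) (snd z))\<^sup>2) \<partial>\<gamma>)"
        unfolding nn_integral_dist_power2_real[OF coupling_D(1,2)[OF q P2_D(2)[OF P(1)]]]
          nn_integral_dist_power2_real[OF coupling_D(1,2)[OF \<gamma> P2_D(2)[OF P(1)]]]
        by (intro nn_integral_mono add_mono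
            order_trans[OF emeasure_quantile_coupling_quadrant_le(1)[OF P] emeasure_coupling_quadrant_ge(1)[OF P \<gamma>]]
            order_trans[OF emeasure_quantile_coupling_quadrant_le(2)[OF P] emeasure_coupling_quadrant_ge(2)[OF P \<gamma>]])
    qed
  qed
  also have "\<dots> = (\<integral>\<^sup>+u. ennreal ((quantile \<alpha> u - quantile \<beta> u)\<^sup>2) \<partial>unif01)"
    unfolding quantile_coupling_def by (subst nn_integral_distr) (auto simp: dist_real_def)
  finally show ?thesis .
qed

lemma W_real_commute:
  fixes \<alpha> \<beta> :: "real measure"
  assumes "\<alpha> \<in> P2" "\<beta> \<in> P2"
  shows "W \<alpha> \<beta> = W \<beta> \<alpha>"
proof -
  have "ennreal ((W \<alpha> \<beta>)\<^sup>2) = ennreal ((W \<beta> \<alpha>)\<^sup>2)"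
    using assms by (simp add: W_real_eq_quantile power2_commute)
  then show ?thesis
    using W_nonneg[of \<alpha> \<beta>] W_nonneg[of \<beta> \<alpha>] by (simp add: power2_eq_iff_nonneg)
qed

text \<open>All quantile functions live on the same space \<open>unif01\<close>, where the claim is
  the triangle inequality of the square norm.\<close>

lemma W_real_triangle:
  fixes \<alpha> \<beta> \<eta> :: "real measure"
  assumes "\<alpha> \<in> P2" "\<beta> \<in> P2" "\<eta> \<in> P2"
  shows "W \<alpha> \<eta> \<le> W \<alpha> \<beta> + W \<beta> \<eta>"
proof -
  note [measurable] = measurable_quantile[OF assms(1)] measurable_quantile[OF assms(2)]
    measurable_quantile[OF assms(3)]
  have "ennreal ((W \<alpha> \<eta>)\<^sup>2) = (\<integral>\<^sup>+u. ennreal (((quantile \<alpha> u - quantile \<beta> u) +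
      (quantile \<beta> u - quantile \<eta> u))\<^sup>2) \<partial>unif01)"
    using assms by (simp add: W_real_eq_quantile)
  also have "\<dots> \<le> ennreal ((W \<alpha> \<beta> + W \<beta> \<eta>)\<^sup>2)"
    using assms by (intro nn_integral_L2_triangle) (auto simp: W_real_eq_quantile W_nonneg)
  finally have "(W \<alpha> \<eta>)\<^sup>2 \<le> (W \<alpha> \<beta> + W \<beta> \<eta>)\<^sup>2"
    by simp
  then show ?thesis
    by (rule power2_le_imp_le) (simp add: W_nonneg)
qed

section \<open>Moments and strips of the uniform measure on the sphere\<close>

declare sets_unif_sphere [measurable_cong]

text \<open>Invariance of the sphere measure is only needed for quarter turns in coordinate planes: they make
  its second moment matrix a multiple of the identity.\<close>

definition quarter_turn :: "'a::euclidean_space \<Rightarrow> 'a \<Rightarrow> 'a \<Rightarrow> 'a" where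
  "quarter_turn i j x = x + (x \<bullet> j - x \<bullet> i) *\<^sub>R i - (x \<bullet> i + x \<bullet> j) *\<^sub>R j"

lemma quarter_turn_inner:
  assumes "i \<in> Basis" "j \<in> Basis" "i \<noteq> j" "b \<in> Basis"
  shows "quarter_turn i j x \<bullet> b = (if b = i then x \<bullet> j else if b = j then - (x \<bullet> i) else x \<bullet> b)"
  using assms by (auto simp: quarter_turn_def inner_Basis algebra_simps)

lemma measurable_quarter_turn [measurable]: "quarter_turn i j \<in> borel_measurable borel"
  unfolding quarter_turn_def[abs_def] by measurable

lemma norm_quarter_turn:
  fixes i j :: "'a::euclidean_space"
  assumes "i \<in> Basis" "j \<in> Basis" "i \<noteq> j"
  shows "norm (quarter_turn i j x) = norm x"
proof -
  have "i \<bullet> i = 1" "j \<bullet> j = 1" "i \<bullet> j = 0" "j \<bullet> i = 0"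
    using assms by (auto simp: inner_Basis)
  then have "quarter_turn i j x \<bullet> quarter_turn i j x = x \<bullet> x"
    by (simp add: quarter_turn_def inner_simps inner_commute[of i x] inner_commute[of j x] algebra_simps)
  then show ?thesis by (simp add: norm_eq)
qed

lemma quarter_turn_scaleR: "quarter_turn i j (c *\<^sub>R x) = c *\<^sub>R quarter_turn i j x"
  by (simp add: quarter_turn_def algebra_simps)

lemma distr_lborel_quarter_turn:
  fixes i j :: "'a::euclidean_space"
  assumes ij: "i \<in> Basis" "j \<in> Basis" "i \<noteq> j"
  shows "distr lborel borel (quarter_turn i j) = lborel"
proof (rule lborel_eqI[symmetric])
  fix l u :: 'a assume lu: "\<And>b. b \<in> Basis \<Longrightarrow> l \<bullet> b \<le> u \<bullet> b"
  \<comment> \<open>Corners of the preimage box: its side along \<open>i\<close> is the reflected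
    side of the box along \<open>j\<close>, and its side along \<open>j\<close> is the original side
    along \<open>i\<close>. The volume is the same product with two factors exchanged.\<close>
  define l' where "l' = l + (- (u \<bullet> j) - l \<bullet> i) *\<^sub>R i + (l \<bullet> i - l \<bullet> j) *\<^sub>R j"
  define u' where "u' = u + (- (l \<bullet> j) - u \<bullet> i) *\<^sub>R i + (u \<bullet> i - u \<bullet> j) *\<^sub>R j"
  have l': "l' \<bullet> b = (if b = i then - (u \<bullet> j) else if b = j then l \<bullet> i else l \<bullet> b)"
    and u': "u' \<bullet> b = (if b = i then - (l \<bullet> j) else if b = j then u \<bullet> i else u \<bullet> b)"
    if "b \<in> Basis" for b
    using that ij by (auto simp: l'_def u'_def inner_Basis algebra_simps)
  have "quarter_turn i j -` box l u = box l' u'"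
  proof (intro set_eqI iffI)
    fix x assume "x \<in> quarter_turn i j -` box l u"
    then have "l \<bullet> b < quarter_turn i j x \<bullet> b \<and> quarter_turn i j x \<bullet> b < u \<bullet> b" if "b \<in> Basis" for b
      using that by (auto simp: mem_box)
    note * = this[unfolded quarter_turn_inner[OF ij]]
    show "x \<in> box l' u'"
      unfolding mem_box
    proof
      fix b :: 'a assume b: "b \<in> Basis"
      show "l' \<bullet> b < x \<bullet> b \<and> x \<bullet> b < u' \<bullet> b"
        using *[OF b] *[OF ij(1)] *[OF ij(2)] ij b by (auto simp: l' u' quarter_turn_inner[OF ij] split: if_splits)
    qed
  next
    fix x assume "x \<in> box l' u'"
    then have *: "l' \<bullet> b < x \<bullet> b \<and> x \<bullet> b < u' \<bullet> b" if "b \<in> Basis" for b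
      using that by (auto simp: mem_box)
    have "l \<bullet> b < quarter_turn i j x \<bullet> b \<and> quarter_turn i j x \<bullet> b < u \<bullet> b" if b: "b \<in> Basis" for b
      using *[OF b] *[OF ij(1)] *[OF ij(2)] ij b
      by (auto simp: l' u' quarter_turn_inner[OF ij] split: if_splits)
    then show "x \<in> quarter_turn i j -` box l u"
      by (simp add: mem_box)
  qed
  then have "emeasure (distr lborel borel (quarter_turn i j)) (box l u) = emeasure lborel (box l' u')"
    by (simp add: emeasure_distr)
  also have "\<dots> = ennreal (\<Prod>b\<in>Basis. (u' - l') \<bullet> b)"
    using lu ij by (intro emeasure_lborel_box) (auto simp: l' u')
  also have "(\<Prod>b\<in>Basis. (u' - l') \<bullet> b) = (\<Prod>b\<in>Basis. (u - l) \<bullet> Transposition.transpose i j b)"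
    using ij by (intro prod.cong) (auto simp: l' u' inner_diff_left Transposition.transpose_def)
  also have "\<dots> = (\<Prod>b\<in>Basis. (u - l) \<bullet> b)"
    using ij by (intro prod.reindex_bij_betw bij_betw_byWitness[where f' = "Transposition.transpose i j"])
      (auto simp: Transposition.transpose_def)
  finally show "emeasure (distr lborel borel (quarter_turn i j)) (box l u) =
    ennreal (\<Prod>b\<in>Basis. (u - l) \<bullet> b)" by simp
qed simp

lemma emeasure_uniform_unit_ball:
  fixes A :: "'a::euclidean_space set"
  assumes "A \<in> sets borel"
  shows "emeasure (uniform_measure lborel (ball 0 1)) A =
    emeasure lborel (ball 0 1 \<inter> A) / emeasure lborel (ball (0::'a) 1)"
  using assms by (intro emeasure_uniform_measure) auto

text \<open>A quarter turn preserves Lebesgue measure and the norm, hence the uniform measure on the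
  ball, and it commutes with radial projection.\<close>

lemma distr_unif_sphere_quarter_turn:
  fixes i j :: "'a::euclidean_space"
  assumes ij: "i \<in> Basis" "j \<in> Basis" "i \<noteq> j"
  shows "distr unif_sphere borel (quarter_turn i j) = unif_sphere"
proof -
  let ?T = "quarter_turn i j" and ?U = "uniform_measure lborel (ball (0::'a) 1)"
  have U: "distr ?U borel ?T = ?U"
  proof (rule measure_eqI)
    fix A assume "A \<in> sets (distr ?U borel ?T)"
    then have [measurable]: "A \<in> sets borel" by simp
    have "?T -` A \<in> sets borel" using measurable_sets[OF measurable_quarter_turn, of A] by simp
    then have "emeasure (distr ?U borel ?T) A =
        emeasure lborel (ball 0 1 \<inter> ?T -` A) / emeasure lborel (ball (0::'a) 1)"
      by (simp add: emeasure_distr emeasure_uniform_unit_ball)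
    also have "ball 0 1 \<inter> ?T -` A = ?T -` (ball 0 1 \<inter> A)"
      by (auto simp: norm_quarter_turn[OF ij])
    also have "emeasure lborel (?T -` (ball 0 1 \<inter> A)) = emeasure (distr lborel borel ?T) (ball 0 1 \<inter> A)"
      by (simp add: emeasure_distr)
    finally show "emeasure (distr ?U borel ?T) A = emeasure ?U A"
      by (simp add: distr_lborel_quarter_turn[OF ij] emeasure_uniform_unit_ball)
  qed simp
  have "distr unif_sphere borel ?T = distr ?U borel (\<lambda>x. ?T (x /\<^sub>R norm x))"
    unfolding unif_sphere_def by (subst distr_distr) (auto simp: comp_def)
  also have "\<dots> = distr ?U borel (\<lambda>x. ?T x /\<^sub>R norm (?T x))"
    by (simp add: quarter_turn_scaleR norm_quarter_turn[OF ij])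
  also have "\<dots> = distr (distr ?U borel ?T) borel (\<lambda>x. x /\<^sub>R norm x)"
    by (subst distr_distr) (auto simp: comp_def)
  finally show ?thesis by (simp add: U unif_sphere_def)
qed

section \<open>Second moments of the sphere measure\<close>

lemma integrable_unif_sphere_inner:
  fixes v w :: "'a::euclidean_space"
  shows "integrable unif_sphere (\<lambda>\<theta>. (\<theta> \<bullet> v) * (\<theta> \<bullet> w))"
proof -
  interpret S: prob_space "unif_sphere :: 'a measure" by (rule prob_space_unif_sphere)
  show ?thesis
  proof (rule S.integrable_const_bound)
    show "AE \<theta> in unif_sphere. norm ((\<theta> \<bullet> v) * (\<theta> \<bullet> w)) \<le> norm v * norm w"
      using AE_unif_sphere
    proof eventually_elim
      case (elim \<theta>)
      then show ?case
        using Cauchy_Schwarz_ineq2[of \<theta> v] Cauchy_Schwarz_ineq2[of \<theta> w]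
        by (auto simp: abs_mult intro!: mult_mono)
    qed
  qed measurable
qed

text \<open>Turning in the plane of \<open>i\<close> and \<open>j\<close> changes the sign of the
  mixed moment and exchanges the two pure ones. The trace is 1 because almost every direction has
  norm 1.\<close>

lemma integral_unif_sphere_Basis:
  fixes i j :: "'a::euclidean_space"
  assumes ij: "i \<in> Basis" "j \<in> Basis"
  shows "(LINT \<theta>|unif_sphere. (\<theta> \<bullet> i) * (\<theta> \<bullet> j)) = (if i = j then 1 / DIM('a) else 0)"
proof -
  interpret S: prob_space "unif_sphere :: 'a measure" by (rule prob_space_unif_sphere)
  define c where "c i j = (LINT \<theta>|unif_sphere. (\<theta> \<bullet> i) * (\<theta> \<bullet> j))" for i j :: 'a
  have turn: "c k l = (LINT \<theta>|unif_sphere. (quarter_turn i j \<theta> \<bullet> k) * (quarter_turn i j \<theta> \<bullet> l))"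
    if "i \<in> Basis" "j \<in> Basis" "i \<noteq> j" for i j k l :: 'a
    unfolding c_def
    by (subst distr_unif_sphere_quarter_turn[OF that, symmetric], subst integral_distr) auto
  have off: "c i j = 0" if "i \<in> Basis" "j \<in> Basis" "i \<noteq> j" for i j :: 'a
  proof -
    have "c i j = (LINT \<theta>|unif_sphere. (\<theta> \<bullet> j) * (- (\<theta> \<bullet> i)))"
      using that by (subst turn[OF that]) (simp add: quarter_turn_inner)
    also have "\<dots> = - c i j" by (simp add: c_def mult.commute)
    finally show ?thesis by simp
  qed
  have diag: "c i i = c j j" if "i \<in> Basis" "j \<in> Basis" for i j :: 'a
  proof (cases "i = j")
    case False
    have "c i i = (LINT \<theta>|unif_sphere. (\<theta> \<bullet> j) * (\<theta> \<bullet> j))"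
      using that False by (subst turn[OF that False]) (simp add: quarter_turn_inner)
    then show ?thesis by (simp add: c_def)
  qed simp
  have "(\<Sum>k\<in>Basis. c k k) = (LINT \<theta>|(unif_sphere :: 'a measure). (\<Sum>k\<in>Basis. (\<theta> \<bullet> k) * (\<theta> \<bullet> k)) :: real)"
    unfolding c_def by (subst Bochner_Integration.integral_sum) (auto intro: integrable_unif_sphere_inner)
  also have "\<dots> = (LINT \<theta>|(unif_sphere :: 'a measure). 1)"
  proof (intro integral_cong_AE)
    show "AE \<theta> in (unif_sphere :: 'a measure). (\<Sum>k\<in>Basis. (\<theta> \<bullet> k) * (\<theta> \<bullet> k)) = (1::real)"
      using AE_unif_sphere by eventually_elim (simp add: euclidean_inner[symmetric] dot_square_norm)
  qed measurable
  also have "\<dots> = 1" using S.prob_space by simp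
  finally have "(\<Sum>k\<in>Basis. c k k) = 1" .
  moreover have "(\<Sum>k\<in>Basis. c k k) = (\<Sum>k\<in>(Basis::'a set). c i i)"
    using diag[OF _ ij(1)] by (intro sum.cong) auto
  ultimately have "DIM('a) * c i i = 1" by simp
  then show ?thesis
    using off ij by (auto simp: c_def field_simps)
qed

text \<open>In coordinates this is the quadratic form of the second moment matrix; it is the source
  of the factor 1/d.\<close>

lemma nn_integral_unif_sphere_inner_power2:
  fixes v :: "'a::euclidean_space"
  shows "(\<integral>\<^sup>+\<theta>. ennreal ((v \<bullet> \<theta>)\<^sup>2) \<partial>unif_sphere) = ennreal ((norm v)\<^sup>2 / DIM('a))"
proof -
  have "integrable unif_sphere (\<lambda>\<theta>. (v \<bullet> \<theta>)\<^sup>2)"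
    using integrable_unif_sphere_inner[of v v] by (simp add: power2_eq_square inner_commute)
  then have "(\<integral>\<^sup>+\<theta>. ennreal ((v \<bullet> \<theta>)\<^sup>2) \<partial>unif_sphere) = ennreal (LINT \<theta>|unif_sphere. (v \<bullet> \<theta>)\<^sup>2)"
    by (intro nn_integral_eq_integral) auto
  also have "(LINT \<theta>|unif_sphere. (v \<bullet> \<theta>)\<^sup>2) =
    (LINT \<theta>|unif_sphere. (\<Sum>i\<in>Basis. \<Sum>j\<in>Basis. ((v \<bullet> i) * (v \<bullet> j)) * ((\<theta> \<bullet> i) * (\<theta> \<bullet> j))))"
  proof (intro Bochner_Integration.integral_cong refl)
    fix \<theta> :: 'a
    have "(v \<bullet> \<theta>)\<^sup>2 = (\<Sum>i\<in>Basis. (v \<bullet> i) * (\<theta> \<bullet> i)) * (\<Sum>j\<in>Basis. (v \<bullet> j) * (\<theta> \<bullet> j))"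
      by (simp only: power2_eq_square euclidean_inner[symmetric])
    then show "(v \<bullet> \<theta>)\<^sup>2 = (\<Sum>i\<in>Basis. \<Sum>j\<in>Basis. ((v \<bullet> i) * (v \<bullet> j)) * ((\<theta> \<bullet> i) * (\<theta> \<bullet> j)))"
      by (simp only: sum_product mult_ac)
  qed
  also have "\<dots> = (\<Sum>i\<in>Basis. \<Sum>j\<in>Basis. ((v \<bullet> i) * (v \<bullet> j)) *
      (LINT \<theta>|unif_sphere. (\<theta> \<bullet> i) * (\<theta> \<bullet> j)))"
    by (simp add: integrable_unif_sphere_inner)
  also have "\<dots> = (\<Sum>i\<in>Basis. \<Sum>j\<in>Basis. if i = j then (v \<bullet> i) * (v \<bullet> j) / DIM('a) else 0)"
    by (intro sum.cong refl) (simp add: integral_unif_sphere_Basis)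
  also have "\<dots> = (norm v)\<^sup>2 / DIM('a)"
    by (simp add: power2_norm_eq_inner euclidean_inner[of v v] sum_divide_distrib)
  finally show ?thesis .
qed

text \<open>About \<open>1 / (2 t)\<close> translates of the strip in direction \<open>e\<close> are disjoint and still lie in the
  ball of radius 2.\<close>

lemma emeasure_ball_strip_le:
  fixes e :: "'a::euclidean_space"
  assumes e: "norm e = 1" and t: "t > 0"
  shows "emeasure lborel {x \<in> ball 0 1. \<bar>e \<bullet> x\<bar> < t} \<le> ennreal (2 * t) * emeasure lborel (ball (0::'a) 2)"
proof -
  define A where "A = {x \<in> ball 0 1. \<bar>e \<bullet> x\<bar> < t}"
  \<comment> \<open>Shifts by multiples \<open>0\<close> to \<open>N - 1\<close> of
    \<open>2 * t\<close>: there are at least \<open>1 / (2 * t)\<close> of them, and the last one is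
    at most 1. For wide strips \<open>N\<close> is still 1.\<close>
  define N where "N = nat \<lfloor>1 / (2 * t)\<rfloor> + 1"
  define B where "B k = (+) (- (2 * t * real k) *\<^sub>R e) -` A" for k :: nat
  have A [measurable]: "A \<in> sets borel" unfolding A_def by measurable
  have B [measurable]: "B k \<in> sets borel" for k
    unfolding B_def using measurable_sets[of "(+) (- (2 * t * real k) *\<^sub>R e)" borel borel A] by simp
  have eB: "emeasure lborel (B k) = emeasure lborel A" for k
  proof -
    have "emeasure lborel A = emeasure (distr lborel borel ((+) (- (2 * t * real k) *\<^sub>R e))) A"
      by (simp add: lborel_distr_plus)
    then show ?thesis by (simp add: emeasure_distr B_def)
  qed
  have Bk: "\<bar>e \<bullet> x - 2 * t * real k\<bar> < t \<and> norm (x - (2 * t * real k) *\<^sub>R e) < 1" if "x \<in> B k" for x k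
    using that e by (auto simp: B_def A_def inner_simps dot_square_norm)
  have disj: "disjoint_family_on B {..<N}"
    unfolding disjoint_family_on_def
  proof safe
    fix k l x assume kl: "k \<noteq> l" and x: "x \<in> B k" "x \<in> B l"
    have "\<bar>2 * t * real k - 2 * t * real l\<bar> < 2 * t"
      using Bk[OF x(1)] Bk[OF x(2)] by linarith
    also have "\<bar>2 * t * real k - 2 * t * real l\<bar> = 2 * t * \<bar>real k - real l\<bar>"
      using t by (simp add: abs_mult right_diff_distrib[symmetric])
    finally have "\<bar>real k - real l\<bar> < 1" using t by simp
    with kl show "x \<in> {}" by linarith
  qed
  have N: "1 / (2 * t) \<le> real N" "2 * t * real (N - 1) \<le> 1"
  proof -
    show "1 / (2 * t) \<le> real N" unfolding N_def by linarith
    have "real (N - 1) \<le> 1 / (2 * t)"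
      unfolding N_def using t by (simp add: of_nat_floor)
    then show "2 * t * real (N - 1) \<le> 1" using t by (simp add: field_simps)
  qed
  have sub: "(\<Union>k<N. B k) \<subseteq> ball 0 2"
  proof safe
    fix x k assume k: "k < N" and x: "x \<in> B k"
    have "norm x \<le> norm (x - (2 * t * real k) *\<^sub>R e) + norm ((2 * t * real k) *\<^sub>R e)"
      by (metis diff_add_cancel norm_triangle_ineq)
    also have "norm ((2 * t * real k) *\<^sub>R e) \<le> 2 * t * real (N - 1)"
      using e t k by simp
    finally show "x \<in> ball 0 2" using Bk[OF x] N(2) by simp
  qed
  have "ennreal (1 / (2 * t)) * emeasure lborel A \<le> ennreal (real N) * emeasure lborel A"
    using N by (intro mult_right_mono ennreal_leI) auto
  also have "\<dots> = (\<Sum>k<N. emeasure lborel (B k))"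
    by (simp add: eB ennreal_of_nat_eq_real_of_nat)
  also have "\<dots> = emeasure lborel (\<Union>k<N. B k)"
    using disj by (intro sum_emeasure) auto
  also have "\<dots> \<le> emeasure lborel (ball (0::'a) 2)"
    using sub by (intro emeasure_mono) auto
  finally have "ennreal (2 * t) * (ennreal (1 / (2 * t)) * emeasure lborel A) \<le>
      ennreal (2 * t) * emeasure lborel (ball (0::'a) 2)"
    by (intro mult_left_mono) auto
  also have "ennreal (2 * t) * (ennreal (1 / (2 * t)) * emeasure lborel A) = emeasure lborel A"
    using t by (subst mult.assoc[symmetric], subst ennreal_mult[symmetric]) auto
  finally show ?thesis unfolding A_def .
qed

text \<open>The radial preimage of a strip in the unit ball lies in the strip of the same width,
  since normalising a vector of norm below 1 lengthens it. The constant is twice the ratio of the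
  volumes of the balls of radius 2 and 1, that is \<open>2^(d+1)\<close>.\<close>

lemma emeasure_unif_sphere_strip_le:
  obtains K :: real where "K > 0"
    "\<And>(e::'a::euclidean_space) t. norm e = 1 \<Longrightarrow> t > 0 \<Longrightarrow>
       emeasure unif_sphere {\<theta>. \<bar>e \<bullet> \<theta>\<bar> < t} \<le> ennreal (K * t)"
proof -
  let ?v1 = "emeasure lborel (ball (0::'a) 1)" and ?v2 = "emeasure lborel (ball (0::'a) 2)"
  define K where "K = 2 * enn2real ?v2 / enn2real ?v1"
  have fin: "?v1 < \<infinity>" "?v2 < \<infinity>" by (rule emeasure_lborel_ball_finite)+
  have pos: "0 < ?v1" "0 < ?v2"
    using emeasure_ball[of 1 "0::'a"] emeasure_ball[of 2 "0::'a"] unit_ball_vol_pos[of "real DIM('a)"] by auto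
  then have pos': "0 < enn2real ?v1" "0 < enn2real ?v2" using fin by (auto simp: enn2real_positive_iff)
  then have K: "K > 0" by (simp add: K_def)
  have "emeasure unif_sphere {\<theta>. \<bar>e \<bullet> \<theta>\<bar> < t} \<le> ennreal (K * t)"
    if e: "norm e = 1" and t: "t > 0" for e :: 'a and t :: real
  proof -
    have "emeasure unif_sphere {\<theta>. \<bar>e \<bullet> \<theta>\<bar> < t} =
        emeasure (uniform_measure lborel (ball 0 1)) {x. \<bar>e \<bullet> (x /\<^sub>R norm x)\<bar> < t}"
      unfolding unif_sphere_def by (subst emeasure_distr) auto
    also have "\<dots> = emeasure lborel (ball 0 1 \<inter> {x. \<bar>e \<bullet> (x /\<^sub>R norm x)\<bar> < t}) / ?v1"
      by (rule emeasure_uniform_unit_ball) measurable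
    also have "\<dots> \<le> emeasure lborel {x \<in> ball 0 1. \<bar>e \<bullet> x\<bar> < t} / ?v1"
    proof (intro divide_right_mono_ennreal emeasure_mono subsetI)
      fix x assume x: "x \<in> ball 0 1 \<inter> {x. \<bar>e \<bullet> (x /\<^sub>R norm x)\<bar> < t}"
      have "\<bar>e \<bullet> x\<bar> < t"
      proof (cases "x = 0")
        case False
        with x have "\<bar>e \<bullet> x\<bar> < t * norm x"
          by (simp add: abs_mult field_simps)
        also have "\<dots> \<le> t * 1" using x t by (intro mult_left_mono) auto
        finally show ?thesis by simp
      qed (use t in auto)
      with x show "x \<in> {x \<in> ball 0 1. \<bar>e \<bullet> x\<bar> < t}" by simp
    qed measurable
    also have "\<dots> \<le> ennreal (2 * t) * ?v2 / ?v1"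
      by (intro divide_right_mono_ennreal emeasure_ball_strip_le e t)
    also have "\<dots> = ennreal (2 * t) * ennreal (enn2real ?v2) / ennreal (enn2real ?v1)"
      using fin by simp
    also have "\<dots> = ennreal (2 * t * enn2real ?v2 / enn2real ?v1)"
      using t pos' by (simp add: ennreal_mult[symmetric] divide_ennreal del: ennreal_enn2real)
    also have "2 * t * enn2real ?v2 / enn2real ?v1 = K * t" by (simp add: K_def)
    finally show "emeasure unif_sphere {\<theta>. \<bar>e \<bullet> \<theta>\<bar> < t} \<le> ennreal (K * t)" .
  qed
  with K show thesis by (rule that)
qed

section \<open>The sliced distance and its length metric\<close>

lemma ennreal_W_power2_le_distr:
  fixes X Y :: "'b \<Rightarrow> 'a::euclidean_space"
  assumes X: "X \<in> borel_measurable M" "distr M borel X \<in> P2"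
    and Y: "Y \<in> borel_measurable M" "distr M borel Y \<in> P2"
  shows "ennreal ((W (distr M borel X) (distr M borel Y))\<^sup>2) \<le>
    (\<integral>\<^sup>+x. ennreal ((dist (X x) (Y x))\<^sup>2) \<partial>M)"
proof -
  note [measurable] = X(1) Y(1)
  let ?\<gamma> = "distr M (borel \<Otimes>\<^sub>M borel) (\<lambda>x. (X x, Y x))"
  have "?\<gamma> \<in> couplings (distr M borel X) (distr M borel Y)"
    by (auto simp: couplings_def distr_distr comp_def)
  then have "ennreal ((W (distr M borel X) (distr M borel Y))\<^sup>2) \<le>
      (\<integral>\<^sup>+z. ennreal ((dist (fst z) (snd z))\<^sup>2) \<partial>?\<gamma>)"
    by (rule ennreal_W_power2_le[OF X(2) Y(2)])
  also have "\<dots> = (\<integral>\<^sup>+x. ennreal ((dist (X x) (Y x))\<^sup>2) \<partial>M)"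
    by (subst nn_integral_distr) auto
  finally show ?thesis .
qed

lemma distr_in_P2:
  fixes X :: "'b \<Rightarrow> 'a::euclidean_space"
  assumes "prob_space M" "X \<in> borel_measurable M" "(\<integral>\<^sup>+x. ennreal ((norm (X x))\<^sup>2) \<partial>M) < \<infinity>"
  shows "distr M borel X \<in> P2"
proof -
  have "prob_space (distr M borel X)"
    using assms by (intro prob_space.prob_space_distr)
  moreover have "(\<integral>\<^sup>+x. ennreal ((norm x)\<^sup>2) \<partial>distr M borel X) = (\<integral>\<^sup>+x. ennreal ((norm (X x))\<^sup>2) \<partial>M)"
    using assms by (subst nn_integral_distr) auto
  ultimately show ?thesis
    using assms by (auto simp: P2_def integrable_iff_bounded)
qed

lemma inner_power2_le: "(x \<bullet> y)\<^sup>2 \<le> (norm x)\<^sup>2 * (norm y)\<^sup>2"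
  by (metis Cauchy_Schwarz_ineq power2_norm_eq_inner)

lemma nn_integral_inner_power2_le:
  assumes "\<mu> \<in> P2"
  shows "(\<integral>\<^sup>+x. ennreal ((x \<bullet> \<theta>)\<^sup>2) \<partial>\<mu>) \<le> ennreal ((norm \<theta>)\<^sup>2) * (\<integral>\<^sup>+x. ennreal ((norm x)\<^sup>2) \<partial>\<mu>)"
proof -
  note [measurable_cong] = P2_D(1)[OF assms]
  have "(\<integral>\<^sup>+x. ennreal ((x \<bullet> \<theta>)\<^sup>2) \<partial>\<mu>) \<le> (\<integral>\<^sup>+x. ennreal ((norm \<theta>)\<^sup>2) * ennreal ((norm x)\<^sup>2) \<partial>\<mu>)"
    by (intro nn_integral_mono)
      (use inner_power2_le[of _ \<theta>] in \<open>simp add: ennreal_mult[symmetric] mult.commute\<close>)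
  also have "\<dots> = ennreal ((norm \<theta>)\<^sup>2) * (\<integral>\<^sup>+x. ennreal ((norm x)\<^sup>2) \<partial>\<mu>)"
    by (intro nn_integral_cmult) measurable
  finally show ?thesis .
qed

text \<open>\<open>unif_sphere\<close> is a measure on the whole space, so projections must be
  controlled for all \<open>\<theta>\<close> and not only for unit vectors.\<close>

lemma proj_in_P2:
  assumes "\<mu> \<in> P2"
  shows "proj \<theta> \<mu> \<in> P2"
proof -
  note [measurable_cong] = P2_D(1)[OF assms]
  have "ennreal ((norm \<theta>)\<^sup>2) * (\<integral>\<^sup>+x. ennreal ((norm x)\<^sup>2) \<partial>\<mu>) < \<infinity>"
    using P2_moment_finite[OF assms] by (simp add: ennreal_mult_less_top)
  with nn_integral_inner_power2_le[OF assms, of \<theta>] show ?thesis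
    unfolding proj_def by (intro distr_in_P2 P2_D(2)[OF assms]) auto
qed

lemma W_proj_proj_le:
  assumes "\<mu> \<in> P2"
  shows "W (proj \<theta> \<mu>) (proj \<theta>' \<mu>) \<le>
    norm (\<theta> - \<theta>') * sqrt (enn2real (\<integral>\<^sup>+x. ennreal ((norm x)\<^sup>2) \<partial>\<mu>))"
proof -
  note [measurable_cong] = P2_D(1)[OF assms]
  let ?m = "\<integral>\<^sup>+x. ennreal ((norm x)\<^sup>2) \<partial>\<mu>"
  have "ennreal ((W (proj \<theta> \<mu>) (proj \<theta>' \<mu>))\<^sup>2) \<le> (\<integral>\<^sup>+x. ennreal ((dist (x \<bullet> \<theta>) (x \<bullet> \<theta>'))\<^sup>2) \<partial>\<mu>)"
    using proj_in_P2[OF assms] unfolding proj_def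
    by (intro ennreal_W_power2_le_distr) auto
  also have "\<dots> = (\<integral>\<^sup>+x. ennreal ((x \<bullet> (\<theta> - \<theta>'))\<^sup>2) \<partial>\<mu>)"
    by (simp add: dist_real_def inner_diff_right)
  also have "\<dots> \<le> ennreal ((norm (\<theta> - \<theta>'))\<^sup>2) * ?m"
    by (rule nn_integral_inner_power2_le[OF assms])
  also have "?m = ennreal (enn2real ?m)"
    using P2_moment_finite[OF assms] by simp
  also have "ennreal ((norm (\<theta> - \<theta>'))\<^sup>2) * \<dots> = ennreal ((norm (\<theta> - \<theta>') * sqrt (enn2real ?m))\<^sup>2)"
    by (simp add: power_mult_distrib ennreal_mult[symmetric])
  finally have "(W (proj \<theta> \<mu>) (proj \<theta>' \<mu>))\<^sup>2 \<le> (norm (\<theta> - \<theta>') * sqrt (enn2real ?m))\<^sup>2"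
    by simp
  then show ?thesis by (rule power2_le_imp_le) simp
qed

text \<open>The one-dimensional triangle inequality makes the distance Lipschitz in
  \<open>\<theta>\<close>, with the root second moments as constant. Measurability enters the
  triangle inequality for \<open>SW\<close>.\<close>

lemma measurable_W_proj:
  assumes "\<mu> \<in> P2" "\<nu> \<in> P2"
  shows "(\<lambda>\<theta>. W (proj \<theta> \<mu>) (proj \<theta> \<nu>)) \<in> borel_measurable borel"
proof (rule borel_measurable_continuous_onI)
  define L where "L = sqrt (enn2real (\<integral>\<^sup>+x. ennreal ((norm x)\<^sup>2) \<partial>\<mu>)) +
    sqrt (enn2real (\<integral>\<^sup>+x. ennreal ((norm x)\<^sup>2) \<partial>\<nu>))"
  note P = proj_in_P2[OF assms(1)] proj_in_P2[OF assms(2)]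
  have le: "W (proj \<theta> \<mu>) (proj \<theta> \<nu>) - W (proj \<theta>' \<mu>) (proj \<theta>' \<nu>) \<le> L * norm (\<theta> - \<theta>')" for \<theta> \<theta>'
  proof -
    have "W (proj \<theta> \<mu>) (proj \<theta> \<nu>) \<le> W (proj \<theta> \<mu>) (proj \<theta>' \<mu>) + W (proj \<theta>' \<mu>) (proj \<theta>' \<nu>) +
        W (proj \<theta>' \<nu>) (proj \<theta> \<nu>)"
      using W_real_triangle[of "proj \<theta> \<mu>" "proj \<theta>' \<mu>" "proj \<theta> \<nu>"]
        W_real_triangle[of "proj \<theta>' \<mu>" "proj \<theta>' \<nu>" "proj \<theta> \<nu>"]
      by (simp add: P)
    with W_proj_proj_le[OF assms(1), of \<theta> \<theta>'] W_proj_proj_le[OF assms(2), of \<theta>' \<theta>] show ?thesis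
      by (simp add: L_def algebra_simps norm_minus_commute)
  qed
  have "L-lipschitz_on UNIV (\<lambda>\<theta>. W (proj \<theta> \<mu>) (proj \<theta> \<nu>))"
  proof (rule lipschitz_onI)
    show "0 \<le> L" by (simp add: L_def)
    fix \<theta> \<theta>'
    show "dist (W (proj \<theta> \<mu>) (proj \<theta> \<nu>)) (W (proj \<theta>' \<mu>) (proj \<theta>' \<nu>)) \<le> L * dist \<theta> \<theta>'"
      using le[of \<theta> \<theta>'] le[of \<theta>' \<theta>] by (simp add: dist_real_def dist_norm norm_minus_commute abs_le_iff)
  qed
  then show "continuous_on UNIV (\<lambda>\<theta>. W (proj \<theta> \<mu>) (proj \<theta> \<nu>))"
    by (rule lipschitz_on_continuous_on)
qed

section \<open>Symmetry, triangle inequality and upper bounds for the sliced distance\<close>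

lemma SW_nonneg: "0 \<le> SW \<mu> \<nu>"
  by (simp add: SW_def)

lemma ennreal_SW_power2:
  assumes "\<mu> \<in> P2" "\<nu> \<in> P2"
  shows "ennreal ((SW \<mu> \<nu>)\<^sup>2) = (\<integral>\<^sup>+\<theta>. ennreal ((W (proj \<theta> \<mu>) (proj \<theta> \<nu>))\<^sup>2) \<partial>unif_sphere)"
  using SW_integral_finite[OF assms] by (simp add: SW_def)

lemma SW_commute:
  assumes "\<mu> \<in> P2" "\<nu> \<in> P2"
  shows "SW \<mu> \<nu> = SW \<nu> \<mu>"
  unfolding SW_def using W_real_commute[OF proj_in_P2[OF assms(1)] proj_in_P2[OF assms(2)]] by simp

lemma SW_triangle:
  fixes \<mu> \<nu> \<rho> :: "'a::euclidean_space measure"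
  assumes "\<mu> \<in> P2" "\<nu> \<in> P2" "\<rho> \<in> P2"
  shows "SW \<mu> \<rho> \<le> SW \<mu> \<nu> + SW \<nu> \<rho>"
proof -
  have "ennreal ((SW \<mu> \<rho>)\<^sup>2) \<le>
    (\<integral>\<^sup>+\<theta>. ennreal ((W (proj \<theta> \<mu>) (proj \<theta> \<nu>) + W (proj \<theta> \<nu>) (proj \<theta> \<rho>))\<^sup>2) \<partial>unif_sphere)"
    unfolding ennreal_SW_power2[OF assms(1,3)]
    by (intro nn_integral_mono ennreal_leI power_mono W_real_triangle proj_in_P2 assms W_nonneg)
  also have "\<dots> \<le> ennreal ((SW \<mu> \<nu> + SW \<nu> \<rho>)\<^sup>2)"
    using measurable_W_proj[OF assms(1,2)] measurable_W_proj[OF assms(2,3)]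
    by (intro nn_integral_L2_triangle)
      (simp_all add: ennreal_SW_power2 assms SW_nonneg cong: measurable_cong_sets)
  finally have "(SW \<mu> \<rho>)\<^sup>2 \<le> (SW \<mu> \<nu> + SW \<nu> \<rho>)\<^sup>2"
    by simp
  then show ?thesis
    by (rule power2_le_imp_le) (simp add: SW_nonneg)
qed

text \<open>In each direction the pair of projected maps is a competitor for the one-dimensional
  distance. Exchanging the integrals leaves the average of a squared inner product over the sphere.
  This form serves couplings and interpolations alike.\<close>

lemma ennreal_SW_power2_le_distr:
  fixes X Y :: "'b \<Rightarrow> 'a::euclidean_space"
  assumes "prob_space M"
    and X: "X \<in> borel_measurable M" "distr M borel X \<in> P2"
    and Y: "Y \<in> borel_measurable M" "distr M borel Y \<in> P2"
  shows "ennreal ((SW (distr M borel X) (distr M borel Y))\<^sup>2) \<le>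
    (\<integral>\<^sup>+x. ennreal ((dist (X x) (Y x))\<^sup>2 / DIM('a)) \<partial>M)"
proof -
  interpret M: prob_space M by fact
  interpret S: prob_space "unif_sphere :: 'a measure" by (rule prob_space_unif_sphere)
  interpret P: pair_sigma_finite "unif_sphere :: 'a measure" M ..
  note [measurable] = X(1) Y(1)
  have "ennreal ((W (proj \<theta> (distr M borel X)) (proj \<theta> (distr M borel Y)))\<^sup>2) \<le>
      (\<integral>\<^sup>+x. ennreal (((X x - Y x) \<bullet> \<theta>)\<^sup>2) \<partial>M)" for \<theta>
  proof -
    have *: "proj \<theta> (distr M borel Z) = distr M borel (\<lambda>x. Z x \<bullet> \<theta>)"
      if "Z \<in> borel_measurable M" for Z
      unfolding proj_def using that by (subst distr_distr) (auto simp: comp_def)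
    show ?thesis
      using ennreal_W_power2_le_distr[of "\<lambda>x. X x \<bullet> \<theta>" M "\<lambda>x. Y x \<bullet> \<theta>"]
        proj_in_P2[OF X(2), of \<theta>] proj_in_P2[OF Y(2), of \<theta>]
      by (simp add: * dist_real_def inner_diff_left)
  qed
  then have "ennreal ((SW (distr M borel X) (distr M borel Y))\<^sup>2) \<le>
      (\<integral>\<^sup>+\<theta>. (\<integral>\<^sup>+x. ennreal (((X x - Y x) \<bullet> \<theta>)\<^sup>2) \<partial>M) \<partial>unif_sphere)"
    unfolding ennreal_SW_power2[OF X(2) Y(2)] by (intro nn_integral_mono)
  also have "\<dots> = (\<integral>\<^sup>+x. (\<integral>\<^sup>+\<theta>. ennreal (((X x - Y x) \<bullet> \<theta>)\<^sup>2) \<partial>unif_sphere) \<partial>M)"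
    by (rule P.Fubini'[symmetric]) measurable
  also have "\<dots> = (\<integral>\<^sup>+x. ennreal ((dist (X x) (Y x))\<^sup>2 / DIM('a)) \<partial>M)"
    by (simp add: nn_integral_unif_sphere_inner_power2 dist_norm)
  finally show ?thesis .
qed

text \<open>Each coupling is the joint law of \<open>fst\<close> and \<open>snd\<close>, so the
  preceding estimate applies to it; the dimension is moved to the left before the infimum is
  taken.\<close>

lemma SW_power2_le_W_power2:
  fixes \<mu> \<nu> :: "'a::euclidean_space measure"
  assumes P: "\<mu> \<in> P2" "\<nu> \<in> P2"
  shows "(SW \<mu> \<nu>)\<^sup>2 \<le> (W \<mu> \<nu>)\<^sup>2 / DIM('a)"
proof -
  have "ennreal (DIM('a) * (SW \<mu> \<nu>)\<^sup>2) \<le> ennreal ((W \<mu> \<nu>)\<^sup>2)"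
    unfolding ennreal_W_power2[OF P]
  proof (rule INF_greatest)
    fix \<gamma> assume "\<gamma> \<in> couplings \<mu> \<nu>"
    note D = coupling_D[OF this P2_D(2)[OF P(1)]]
    have [measurable]: "fst \<in> borel_measurable \<gamma>" "snd \<in> borel_measurable \<gamma>" using D by auto
    have "ennreal ((SW \<mu> \<nu>)\<^sup>2) \<le> (\<integral>\<^sup>+z. ennreal ((dist (fst z) (snd z))\<^sup>2 / DIM('a)) \<partial>\<gamma>)"
      using ennreal_SW_power2_le_distr[of \<gamma> fst snd] D P by simp
    then have "ennreal DIM('a) * ennreal ((SW \<mu> \<nu>)\<^sup>2) \<le>
        ennreal DIM('a) * (\<integral>\<^sup>+z. ennreal ((dist (fst z) (snd z))\<^sup>2 / DIM('a)) \<partial>\<gamma>)"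
      by (intro mult_left_mono) auto
    also have "\<dots> = (\<integral>\<^sup>+z. ennreal DIM('a) * ennreal ((dist (fst z) (snd z))\<^sup>2 / DIM('a)) \<partial>\<gamma>)"
      by (rule nn_integral_cmult[symmetric]) measurable
    also have "\<dots> = (\<integral>\<^sup>+z. ennreal ((dist (fst z) (snd z))\<^sup>2) \<partial>\<gamma>)"
      by (subst ennreal_mult[symmetric]) auto
    finally show "ennreal (DIM('a) * (SW \<mu> \<nu>)\<^sup>2) \<le> (\<integral>\<^sup>+z. ennreal ((dist (fst z) (snd z))\<^sup>2) \<partial>\<gamma>)"
      by (simp add: ennreal_mult)
  qed
  then have "DIM('a) * (SW \<mu> \<nu>)\<^sup>2 \<le> (W \<mu> \<nu>)\<^sup>2"
    by simp
  then show ?thesis by (simp add: field_simps)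
qed

text \<open>Replaces the \<open>Lim\<close> in the length by an integrable function \<open>m\<close>
  that also bounds the distance of the end points.\<close>

lemma SW_length_eq_integral:
  fixes c :: "real \<Rightarrow> 'a::euclidean_space measure"
  assumes "SW_abs_continuous c"
  obtains m where "integrable lborel m" "\<And>t. 0 \<le> m t"
    "SW_length c = ereal (LINT r:{0<..<1}|lborel. m r)"
    "SW (c 0) (c 1) \<le> (LINT r:{0<..<1}|lborel. m r)"
    "AE t in lborel. t \<in> {0..1} \<longrightarrow>
       ((\<lambda>s. SW (c s) (c t) / \<bar>s - t\<bar>) \<longlongrightarrow> m t) (at t within {0..1})"
proof -
  have P: "\<And>t. t \<in> {0..1} \<Longrightarrow> c t \<in> P2"
    using assms by (auto simp: SW_abs_continuous_def)
  obtain g :: "real \<Rightarrow> real" where g: "set_integrable lborel {0<..<1} g"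
    "\<And>s t. 0 \<le> s \<Longrightarrow> s \<le> t \<Longrightarrow> t \<le> 1 \<Longrightarrow> SW (c s) (c t) \<le> (LINT r:{s<..<t}|lborel. g r)"
    using assms by (auto simp: SW_abs_continuous_def)
  obtain m where m: "integrable lborel m" "\<And>t. 0 \<le> m t"
    "\<And>s t. 0 \<le> s \<Longrightarrow> s \<le> t \<Longrightarrow> t \<le> 1 \<Longrightarrow> SW (c s) (c t) \<le> (LINT r:{s<..<t}|lborel. m r)"
    and lim: "AE t in lborel. t \<in> {0..1} \<longrightarrow>
       ((\<lambda>s. SW (c s) (c t) / \<bar>s - t\<bar>) \<longlongrightarrow> m t) (at t within {0..1})"
    using metric_derivative_exists[of "\<lambda>s t. SW (c s) (c t)" g] SW_commute[OF P P] SW_triangle[OF P P P] g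
    by blast
  \<comment> \<open>The point 0 is dropped on the right so that the integral over a half-open
    interval formula applies. The limit filter is nontrivial at each point of the unit interval,
    which makes \<open>Lim\<close> equal to the limit.\<close>
  have "AE t in lborel. ennreal (SW_metric_deriv c t) * indicator {0..1} t = ennreal (m t) * indicator {0<..1} t"
    using lim AE_lborel_singleton[of 0]
  proof eventually_elim
    case (elim t)
    show ?case
    proof (cases "t \<in> {0..1}")
      case True
      then have "at t within {0..1} \<noteq> bot"
        by (simp add: trivial_limit_within islimpt_Icc)
      then have "SW_metric_deriv c t = m t"
        unfolding SW_metric_deriv_def using elim True by (intro tendsto_Lim) auto
      with True elim show ?thesis by (auto simp: indicator_def)
    qed (auto simp: indicator_def)
  qed
  then have "(\<integral>\<^sup>+t\<in>{0..1}. ennreal (SW_metric_deriv c t) \<partial>lborel) = ennreal (LINT r:{0<..<1}|lborel. m r)"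
    using nn_integral_indicator_Ioc[OF m(1,2), of 0 1] nn_integral_cong_AE by metis
  then have "SW_length c = ereal (LINT r:{0<..<1}|lborel. m r)"
    unfolding SW_length_def using m(2)
    by (simp add: enn2ereal_ennreal set_lebesgue_integral_def)
  then show thesis
    using m lim m(3)[of 0 1] by (intro that) auto
qed

lemma SW_le_ell_SW: "ereal (SW \<mu> \<nu>) \<le> ell_SW \<mu> \<nu>"
  unfolding ell_SW_def
proof (rule INF_greatest)
  fix c assume "c \<in> {c. SW_abs_continuous c \<and> c 0 = \<mu> \<and> c 1 = \<nu>}"
  then show "ereal (SW \<mu> \<nu>) \<le> SW_length c"
    by (elim CollectE conjE SW_length_eq_integral) auto
qed

lemma SW_lipschitz_imp_abs_continuous:
  assumes "\<And>t. t \<in> {0..1} \<Longrightarrow> c t \<in> P2"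
    and "\<And>s t. s \<in> {0..1} \<Longrightarrow> t \<in> {0..1} \<Longrightarrow> SW (c s) (c t) \<le> L * \<bar>s - t\<bar>"
  shows "SW_abs_continuous c"
proof -
  have "SW (c s) (c t) \<le> (LINT r:{s<..<t}|lborel. L)" if "0 \<le> s" "s \<le> t" "t \<le> 1" for s t
    using assms(2)[of s t] that by (simp add: set_lebesgue_integral_def mult.commute)
  moreover have "set_integrable lborel {0<..<1::real} (\<lambda>_. L)"
    by (simp add: set_integrable_def)
  ultimately show ?thesis
    using assms(1) unfolding SW_abs_continuous_def by blast
qed

text \<open>Every difference quotient is at most \<open>L\<close>, hence so is the metric derivative
  almost everywhere, and the parameter interval has length 1.\<close>

lemma SW_length_le_lipschitz:
  assumes P: "\<And>t. t \<in> {0..1} \<Longrightarrow> c t \<in> P2"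
    and L: "\<And>s t. s \<in> {0..1} \<Longrightarrow> t \<in> {0..1} \<Longrightarrow> SW (c s) (c t) \<le> L * \<bar>s - t\<bar>"
  shows "SW_length c \<le> ereal L"
proof -
  have "SW_abs_continuous c"
    using P L by (rule SW_lipschitz_imp_abs_continuous)
  then obtain m where m: "integrable lborel m" "\<And>t. 0 \<le> m t"
    "SW_length c = ereal (LINT r:{0<..<1}|lborel. m r)"
    "SW (c 0) (c 1) \<le> (LINT r:{0<..<1}|lborel. m r)"
    "AE t in lborel. t \<in> {0..1} \<longrightarrow>
       ((\<lambda>s. SW (c s) (c t) / \<bar>s - t\<bar>) \<longlongrightarrow> m t) (at t within {0..1})"
    by (rule SW_length_eq_integral) blast
  have "AE t in lborel. t \<in> {0..1} \<longrightarrow> m t \<le> L"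
    using m(5)
  proof eventually_elim
    case (elim t)
    show ?case
    proof
      assume t: "t \<in> {0..1}"
      then have nb: "at t within {0..1} \<noteq> bot"
        by (simp add: trivial_limit_within islimpt_Icc)
      have "\<forall>\<^sub>F s in at t within {0..1}. SW (c s) (c t) / \<bar>s - t\<bar> \<le> L"
        unfolding eventually_at_filter
        using L t by (auto simp: field_simps intro!: always_eventually)
      then show "m t \<le> L"
        using elim t by (intro tendsto_upperbound[OF _ _ nb]) auto
    qed
  qed
  then have "(LINT r:{0<..<1}|lborel. m r) \<le> (LINT r:{0<..<1::real}|lborel. L)"
    unfolding set_lebesgue_integral_def
  proof (intro integral_mono_AE)
    show "integrable lborel (\<lambda>x. indicator {0<..<1} x *\<^sub>R m x)"
      using set_integrable_lborel_subset[OF m(1), of "{0<..<1}"] by (simp add: set_integrable_def)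
    show "integrable lborel (\<lambda>x::real. indicator {0<..<1} x *\<^sub>R L)"
      by simp
  qed (auto simp: indicator_def elim!: eventually_mono)
  also have "\<dots> = L" by (simp add: set_lebesgue_integral_def)
  finally show ?thesis by (simp add: m(3))
qed

text \<open>Between times s and t each particle moves by (t - s) times its total displacement,
  whatever the coupling. Stating this for all couplings allows the infimum to be taken
  afterwards.\<close>

lemma ell_SW_le_coupling:
  fixes \<mu> \<nu> :: "'a::euclidean_space measure"
  assumes P: "\<mu> \<in> P2" "\<nu> \<in> P2" and \<gamma>: "\<gamma> \<in> couplings \<mu> \<nu>"
    and k: "(\<integral>\<^sup>+z. ennreal ((dist (fst z) (snd z))\<^sup>2) \<partial>\<gamma>) = ennreal k" "0 \<le> k"
  shows "ell_SW \<mu> \<nu> \<le> ereal (sqrt (k / DIM('a)))"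
proof -
  note D = coupling_D[OF \<gamma> P2_D(2)[OF P(1)]]
  have [measurable]: "fst \<in> borel_measurable \<gamma>" "snd \<in> borel_measurable \<gamma>" using D by auto
  interpret \<gamma>: prob_space \<gamma> by (rule D)
  define X where "X t z = (1 - t) *\<^sub>R fst z + t *\<^sub>R snd z" for t :: real and z :: "'a \<times> 'a"
  have X [measurable]: "X t \<in> borel_measurable \<gamma>" for t unfolding X_def[abs_def] by measurable
  define c where "c t = distr \<gamma> borel (X t)" for t
  have "norm (X t z) \<le> norm (fst z) + norm (snd z)" if "t \<in> {0..1}" for t z
    unfolding X_def using that
    by (intro order_trans[OF norm_triangle_ineq] add_mono) (auto intro!: mult_left_le_one_le)
  then have X_le: "(norm (X t z))\<^sup>2 \<le> 2 * (norm (fst z))\<^sup>2 + 2 * (norm (snd z))\<^sup>2"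
    if "t \<in> {0..1}" for t z
    using that power_mono[of "norm (X t z)" "norm (fst z) + norm (snd z)" 2]
      zero_le_power2[of "norm (fst z) - norm (snd z)"]
    by (simp add: power2_sum power2_diff)
  have cP: "c t \<in> P2" if t: "t \<in> {0..1}" for t
    unfolding c_def
  proof (rule distr_in_P2)
    have "(\<integral>\<^sup>+z. ennreal ((norm (X t z))\<^sup>2) \<partial>\<gamma>) \<le>
        (\<integral>\<^sup>+z. 2 * ennreal ((norm (fst z))\<^sup>2) + 2 * ennreal ((norm (snd z))\<^sup>2) \<partial>\<gamma>)"
    proof (intro nn_integral_mono)
      fix z
      show "ennreal ((norm (X t z))\<^sup>2) \<le> 2 * ennreal ((norm (fst z))\<^sup>2) + 2 * ennreal ((norm (snd z))\<^sup>2)"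
        using ennreal_leI[OF X_le[OF t, of z]] by (simp add: ennreal_plus ennreal_mult)
    qed
    also have "\<dots> = 2 * (\<integral>\<^sup>+z. ennreal ((norm (fst z))\<^sup>2) \<partial>\<gamma>) + 2 * (\<integral>\<^sup>+z. ennreal ((norm (snd z))\<^sup>2) \<partial>\<gamma>)"
      by (simp add: nn_integral_add nn_integral_cmult)
    also have "(\<integral>\<^sup>+z. ennreal ((norm (fst z))\<^sup>2) \<partial>\<gamma>) = (\<integral>\<^sup>+x. ennreal ((norm x)\<^sup>2) \<partial>\<mu>)"
      unfolding D(4)[symmetric] by (subst nn_integral_distr) auto
    also have "(\<integral>\<^sup>+z. ennreal ((norm (snd z))\<^sup>2) \<partial>\<gamma>) = (\<integral>\<^sup>+x. ennreal ((norm x)\<^sup>2) \<partial>\<nu>)"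
      unfolding D(5)[symmetric] by (subst nn_integral_distr) auto
    also have "2 * (\<integral>\<^sup>+x. ennreal ((norm x)\<^sup>2) \<partial>\<mu>) + 2 * (\<integral>\<^sup>+x. ennreal ((norm x)\<^sup>2) \<partial>\<nu>) < \<infinity>"
      using P2_moment_finite[OF P(1)] P2_moment_finite[OF P(2)] by (auto simp: ennreal_mult_less_top)
    finally show "(\<integral>\<^sup>+z. ennreal ((norm (X t z))\<^sup>2) \<partial>\<gamma>) < \<infinity>" .
  qed (auto intro: D)
  have "SW (c s) (c t) \<le> sqrt (k / DIM('a)) * \<bar>s - t\<bar>" if st: "s \<in> {0..1}" "t \<in> {0..1}" for s t
  proof -
    have "ennreal ((SW (c s) (c t))\<^sup>2) \<le> (\<integral>\<^sup>+z. ennreal ((dist (X s z) (X t z))\<^sup>2 / DIM('a)) \<partial>\<gamma>)"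
      using cP[OF st(1)] cP[OF st(2)] unfolding c_def
      by (intro ennreal_SW_power2_le_distr D X)
    also have "\<dots> = (\<integral>\<^sup>+z. ennreal (\<bar>s - t\<bar>\<^sup>2 / DIM('a)) * ennreal ((dist (fst z) (snd z))\<^sup>2) \<partial>\<gamma>)"
    proof (intro nn_integral_cong)
      fix z
      have "X s z - X t z = (t - s) *\<^sub>R (fst z - snd z)"
        by (simp add: X_def algebra_simps)
      then have "dist (X s z) (X t z) = \<bar>s - t\<bar> * dist (fst z) (snd z)"
        by (simp add: dist_norm abs_minus_commute)
      then show "ennreal ((dist (X s z) (X t z))\<^sup>2 / DIM('a)) =
          ennreal (\<bar>s - t\<bar>\<^sup>2 / DIM('a)) * ennreal ((dist (fst z) (snd z))\<^sup>2)"
        by (simp add: power_mult_distrib ennreal_mult[symmetric])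
    qed
    also have "\<dots> = ennreal (\<bar>s - t\<bar>\<^sup>2 / DIM('a)) * ennreal k"
      unfolding k(1)[symmetric] by (intro nn_integral_cmult) measurable
    also have "\<dots> = ennreal ((sqrt (k / DIM('a)) * \<bar>s - t\<bar>)\<^sup>2)"
      using k(2) by (simp add: ennreal_mult[symmetric] power_mult_distrib)
    finally have "(SW (c s) (c t))\<^sup>2 \<le> (sqrt (k / DIM('a)) * \<bar>s - t\<bar>)\<^sup>2"
      by simp
    then show ?thesis
      by (rule power2_le_imp_le) (simp add: k(2))
  qed
  note lip = this
  have "c 0 = \<mu>" "c 1 = \<nu>"
    using D(4,5) by (simp_all add: c_def X_def[abs_def])
  with SW_lipschitz_imp_abs_continuous[OF cP lip] have "ell_SW \<mu> \<nu> \<le> SW_length c"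
    unfolding ell_SW_def by (intro INF_lower) simp
  also have "\<dots> \<le> ereal (sqrt (k / DIM('a)))"
    by (rule SW_length_le_lipschitz[OF cP lip])
  finally show ?thesis .
qed

lemma ell_SW_power2_bounds:
  fixes \<mu> \<nu> :: "'a::euclidean_space measure"
  assumes P: "\<mu> \<in> P2" "\<nu> \<in> P2"
  shows "ereal ((SW \<mu> \<nu>)\<^sup>2) \<le> (ell_SW \<mu> \<nu>)\<^sup>2"
    and "(ell_SW \<mu> \<nu>)\<^sup>2 \<le> ereal ((W \<mu> \<nu>)\<^sup>2 / DIM('a))"
proof -
  have cost: "(\<integral>\<^sup>+z. ennreal ((dist (fst z) (snd z))\<^sup>2) \<partial>\<gamma>) < \<infinity>" if "\<gamma> \<in> couplings \<mu> \<nu>" for \<gamma>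
    by (rule le_less_trans[OF nn_integral_dist_coupling[OF P that]])
      (use P2_moment_finite[OF P(1)] P2_moment_finite[OF P(2)] in \<open>auto simp: ennreal_mult_less_top\<close>)
  have le: "ell_SW \<mu> \<nu> \<le> ereal (sqrt (enn2real (\<integral>\<^sup>+z. ennreal ((dist (fst z) (snd z))\<^sup>2) \<partial>\<gamma>) / DIM('a)))"
    if "\<gamma> \<in> couplings \<mu> \<nu>" for \<gamma>
    using cost[OF that] by (intro ell_SW_le_coupling[OF P that]) auto
  note SW = SW_le_ell_SW[of \<mu> \<nu>]
  \<comment> \<open>The product coupling has finite cost, so \<open>ell_SW\<close> is a real number
    and squares can be compared in the reals.\<close>
  from le[OF pair_measure_coupling[OF P]] SW obtain r where r: "ell_SW \<mu> \<nu> = ereal r"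
    by (cases "ell_SW \<mu> \<nu>") auto
  have r0: "SW \<mu> \<nu> \<le> r" "0 \<le> r" using SW SW_nonneg[of \<mu> \<nu>] by (auto simp: r)
  show "ereal ((SW \<mu> \<nu>)\<^sup>2) \<le> (ell_SW \<mu> \<nu>)\<^sup>2"
    using r0 SW_nonneg[of \<mu> \<nu>] by (simp add: r power_mono)
  have "ennreal (DIM('a) * r\<^sup>2) \<le> ennreal ((W \<mu> \<nu>)\<^sup>2)"
    unfolding ennreal_W_power2[OF P]
  proof (rule INF_greatest)
    fix \<gamma> assume \<gamma>: "\<gamma> \<in> couplings \<mu> \<nu>"
    define k where "k = enn2real (\<integral>\<^sup>+z. ennreal ((dist (fst z) (snd z))\<^sup>2) \<partial>\<gamma>)"
    have "r \<le> sqrt (k / DIM('a))" using le[OF \<gamma>] by (simp add: r k_def)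
    then have "r\<^sup>2 \<le> (sqrt (k / DIM('a)))\<^sup>2" using r0 by (intro power_mono)
    also have "\<dots> = k / DIM('a)" by (simp add: k_def)
    finally have "ennreal (DIM('a) * r\<^sup>2) \<le> ennreal k" by (intro ennreal_leI) (simp add: field_simps)
    also have "ennreal k = (\<integral>\<^sup>+z. ennreal ((dist (fst z) (snd z))\<^sup>2) \<partial>\<gamma>)"
      unfolding k_def using cost[OF \<gamma>] by simp
    finally show "ennreal (DIM('a) * r\<^sup>2) \<le> (\<integral>\<^sup>+z. ennreal ((dist (fst z) (snd z))\<^sup>2) \<partial>\<gamma>)" .
  qed
  then have "DIM('a) * r\<^sup>2 \<le> (W \<mu> \<nu>)\<^sup>2" by simp
  then show "(ell_SW \<mu> \<nu>)\<^sup>2 \<le> ereal ((W \<mu> \<nu>)\<^sup>2 / DIM('a))"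
    by (simp add: r field_simps)
qed

section \<open>Measures near a finitely supported measure\<close>

text \<open>Every coupling of the projected measures transports a point to some projected atom, so it costs at
  least the squared distance to the nearest one.\<close>

lemma W_proj_finite_support_ge:
  fixes \<mu> \<nu> :: "'a::euclidean_space measure"
  assumes P: "\<mu> \<in> P2" "\<nu> \<in> P2" and F: "finite F" "AE x in \<mu>. x \<in> F"
  shows "(\<integral>\<^sup>+z. (INF y\<in>F. ennreal (((z - y) \<bullet> \<theta>)\<^sup>2)) \<partial>\<nu>) \<le> ennreal ((W (proj \<theta> \<mu>) (proj \<theta> \<nu>))\<^sup>2)"
  unfolding ennreal_W_power2[OF proj_in_P2[OF P(1)] proj_in_P2[OF P(2)]]
proof (rule INF_greatest)
  fix \<kappa> assume \<kappa>: "\<kappa> \<in> couplings (proj \<theta> \<mu>) (proj \<theta> \<nu>)"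
  note D = coupling_D[OF \<kappa> P2_D(2)[OF proj_in_P2[OF P(1)]]]
  note [measurable] = D(6,7)
  note [measurable_cong] = P2_D(1)[OF P(1)] P2_D(1)[OF P(2)]
  have cF: "countable F" using F(1) by (rule countable_finite)
  \<comment> \<open>The nearest-atom cost sees \<open>z\<close> only through its projection, so it
    can be integrated against \<open>proj \<theta> \<nu>\<close>.\<close>
  define f where "f b = (INF y\<in>F. ennreal ((b - y \<bullet> \<theta>)\<^sup>2))" for b
  have [measurable]: "f \<in> borel_measurable borel"
    unfolding f_def by (intro borel_measurable_INF cF) measurable
  have "closed ((\<lambda>y. y \<bullet> \<theta>) ` F)"
    using F(1) by (intro finite_imp_closed finite_imageI)
  then have [measurable]: "(\<lambda>y. y \<bullet> \<theta>) ` F \<in> sets borel"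
    by (rule borel_closed)
  have "AE x in \<mu>. x \<bullet> \<theta> \<in> (\<lambda>y. y \<bullet> \<theta>) ` F"
    using F(2) by eventually_elim auto
  then have "AE a in distr \<kappa> borel fst. a \<in> (\<lambda>y. y \<bullet> \<theta>) ` F"
    unfolding D(4) proj_def by (subst AE_distr_iff) auto
  then have AE: "AE z in \<kappa>. fst z \<in> (\<lambda>y. y \<bullet> \<theta>) ` F"
    by (rule AE_distrD[rotated]) measurable
  have "(\<integral>\<^sup>+z. (INF y\<in>F. ennreal (((z - y) \<bullet> \<theta>)\<^sup>2)) \<partial>\<nu>) = (\<integral>\<^sup>+b. f b \<partial>proj \<theta> \<nu>)"
    unfolding proj_def by (subst nn_integral_distr) (auto simp: f_def inner_diff_left)
  also have "\<dots> = (\<integral>\<^sup>+z. f (snd z) \<partial>\<kappa>)"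
    unfolding D(5)[symmetric] by (subst nn_integral_distr) auto
  also have "\<dots> \<le> (\<integral>\<^sup>+z. ennreal ((dist (fst z) (snd z))\<^sup>2) \<partial>\<kappa>)"
  proof (rule nn_integral_mono_AE)
    show "AE z in \<kappa>. f (snd z) \<le> ennreal ((dist (fst z) (snd z))\<^sup>2)"
      using AE
    proof eventually_elim
      case (elim z)
      then obtain y where "y \<in> F" "fst z = y \<bullet> \<theta>" by auto
      then show ?case
        unfolding f_def by (intro INF_lower2[of y]) (auto simp: dist_real_def power2_commute)
    qed
  qed
  finally show "(\<integral>\<^sup>+z. (INF y\<in>F. ennreal (((z - y) \<bullet> \<theta>)\<^sup>2)) \<partial>\<nu>) \<le>
    (\<integral>\<^sup>+z. ennreal ((dist (fst z) (snd z))\<^sup>2) \<partial>\<kappa>)" .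
qed

text \<open>The sum accounts for the directions in which some atom other than \<open>x\<close> projects too close to \<open>x\<close>.\<close>

lemma inner_power2_le_nearest:
  fixes x z \<theta> :: "'a::euclidean_space"
  assumes \<theta>: "norm \<theta> = 1" and F: "finite F" "x \<in> F"
    and sep: "\<And>y. y \<in> F \<Longrightarrow> y \<noteq> x \<Longrightarrow> l \<le> norm (y - x)"
    and w: "norm (z - x) \<le> w" "0 < w" and l: "0 < l"
  shows "ennreal (((z - x) \<bullet> \<theta>)\<^sup>2) \<le> (INF y\<in>F. ennreal (((z - y) \<bullet> \<theta>)\<^sup>2)) +
    (\<Sum>y\<in>F - {x}. ennreal ((norm (z - x))\<^sup>2) *
       indicator {\<theta>. \<bar>((y - x) /\<^sub>R norm (y - x)) \<bullet> \<theta>\<bar> < 2 * w / l} \<theta>)"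
    (is "_ \<le> ?I + sum ?g _")
proof -
  have v: "\<bar>(z - x) \<bullet> \<theta>\<bar> \<le> norm (z - x)"
    using Cauchy_Schwarz_ineq2[of "z - x" \<theta>] \<theta> by simp
  show ?thesis
  \<comment> \<open>In a bad direction the summand of one offending atom already dominates, because
    a projection shortens \<open>z - x\<close>; otherwise \<open>x\<close> is shown to remain the
    nearest atom after projection.\<close>
  proof (cases "\<exists>y\<in>F - {x}. \<bar>((y - x) /\<^sub>R norm (y - x)) \<bullet> \<theta>\<bar> < 2 * w / l")
    case True
    then obtain y where y: "y \<in> F - {x}" "\<bar>((y - x) /\<^sub>R norm (y - x)) \<bullet> \<theta>\<bar> < 2 * w / l" by blast
    have "((z - x) \<bullet> \<theta>)\<^sup>2 \<le> (norm (z - x))\<^sup>2"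
      using v by (simp add: abs_le_square_iff[symmetric])
    then have "ennreal (((z - x) \<bullet> \<theta>)\<^sup>2) \<le> ?g y"
      using y(2) by (simp add: indicator_def ennreal_leI)
    also have "\<dots> \<le> sum ?g (F - {x})"
      using F(1) y(1) by (intro member_le_sum) auto
    finally show ?thesis by (rule add_increasing[rotated]) simp
  next
    case False
    have "ennreal (((z - x) \<bullet> \<theta>)\<^sup>2) \<le> ?I"
    proof (intro INF_greatest ennreal_leI)
      fix y assume y: "y \<in> F"
      have "\<bar>(z - x) \<bullet> \<theta>\<bar> \<le> \<bar>(z - y) \<bullet> \<theta>\<bar>"
      proof (cases "y = x")
        case neq: False
        have pos: "0 < norm (y - x)" using neq by simp
        \<comment> \<open>Multiplying by the separation turns this into |(y - x) \<bullet>
          \<open>\<theta>\<close>| at least \<open>2 * w\<close>. As |(z - x) \<bullet>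
          \<open>\<theta>\<close>| is at most \<open>w\<close>, the projected distance from
          \<open>z\<close> to \<open>y\<close> is at least \<open>w\<close>; this is where the 2 in
          the strip width comes from.\<close>
        have "2 * w / l \<le> \<bar>((y - x) /\<^sub>R norm (y - x)) \<bullet> \<theta>\<bar>"
          using False y neq by force
        also have "\<dots> = \<bar>(y - x) \<bullet> \<theta>\<bar> / norm (y - x)"
          using pos by (simp add: abs_mult divide_inverse mult.commute)
        finally have "2 * w / l * norm (y - x) \<le> \<bar>(y - x) \<bullet> \<theta>\<bar>"
          using pos by (simp add: pos_le_divide_eq)
        moreover have "2 * w / l * l \<le> 2 * w / l * norm (y - x)"
          using w l sep[OF y neq] by (intro mult_left_mono) auto
        moreover have "2 * w / l * l = 2 * w"
          using l by simp
        moreover have "(z - y) \<bullet> \<theta> = (z - x) \<bullet> \<theta> - (y - x) \<bullet> \<theta>"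
          by (simp add: inner_diff_left)
        ultimately show ?thesis using v w by linarith
      qed simp
      then show "((z - x) \<bullet> \<theta>)\<^sup>2 \<le> ((z - y) \<bullet> \<theta>)\<^sup>2"
        by (simp add: abs_le_square_iff)
    qed
    then show ?thesis by (rule add_increasing2[rotated]) simp
  qed
qed

lemma borel_measurable_INF_nearest:
  fixes F :: "'a::euclidean_space set"
  assumes "finite F" "f \<in> borel_measurable M" "g \<in> borel_measurable M"
  shows "(\<lambda>p. INF y\<in>F. ennreal (((f p - y) \<bullet> g p)\<^sup>2)) \<in> borel_measurable M"
  by (intro borel_measurable_INF countable_finite[OF assms(1)] measurable_compose[OF _ measurable_ennreal]
      borel_measurable_power borel_measurable_inner borel_measurable_diff borel_measurable_const assms)

text \<open>The pointwise comparison is averaged over the sphere and then over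
  \<open>\<gamma>\<close>. Because the loss is proportional to the squared displacement, it comes
  back as a multiple of \<open>k\<close>.\<close>

lemma SW_power2_ge_coupling_cost:
  fixes \<mu> \<nu> :: "'a::euclidean_space measure"
  assumes strip: "\<And>(e::'a) t. norm e = 1 \<Longrightarrow> t > 0 \<Longrightarrow>
       emeasure unif_sphere {\<theta>. \<bar>e \<bullet> \<theta>\<bar> < t} \<le> ennreal (K * t)" and K: "0 \<le> K"
    and P: "\<mu> \<in> P2" "\<nu> \<in> P2" and F: "finite F" "AE x in \<mu>. x \<in> F"
    and sep: "\<And>x y. x \<in> F \<Longrightarrow> y \<in> F \<Longrightarrow> y \<noteq> x \<Longrightarrow> l \<le> dist x y"
    and \<gamma>: "\<gamma> \<in> couplings \<mu> \<nu>" "AE z in \<gamma>. dist (fst z) (snd z) \<le> w"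
    and w: "0 < w" and l: "0 < l"
    and k: "(\<integral>\<^sup>+z. ennreal ((dist (fst z) (snd z))\<^sup>2) \<partial>\<gamma>) = ennreal k" "0 \<le> k"
  shows "k / DIM('a) \<le> (SW \<mu> \<nu>)\<^sup>2 + real (card F) * K * (2 * w / l) * k"
proof -
  note D = coupling_D[OF \<gamma>(1) P2_D(2)[OF P(1)]]
  note [measurable] = D(6,7)
  interpret \<gamma>: prob_space \<gamma> by (rule D)
  interpret S: prob_space "unif_sphere :: 'a measure" by (rule prob_space_unif_sphere)
  interpret Pr: pair_sigma_finite "unif_sphere :: 'a measure" \<gamma> ..
  define t where "t = 2 * w / l"
  have t: "0 < t" using w l by (simp add: t_def)
  define \<phi> where "\<phi> \<theta> z = (INF y\<in>F. ennreal (((z - y) \<bullet> \<theta>)\<^sup>2))" for \<theta> z :: 'a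
  \<comment> \<open>General \<open>f\<close> and \<open>g\<close> cover joint measurability, needed
    for the exchange of integrals, and measurability in each variable alone.\<close>
  have \<phi>_meas: "(\<lambda>p. \<phi> (f p) (g p)) \<in> borel_measurable M"
    if "f \<in> borel_measurable M" "g \<in> borel_measurable M"
    for f g :: "'c \<Rightarrow> 'a" and M
    unfolding \<phi>_def by (rule borel_measurable_INF_nearest[OF F(1) that(2,1)])
  have [measurable]: "finite F \<Longrightarrow> F \<in> sets borel"
    by (intro borel_closed finite_imp_closed)
  have "AE x in distr \<gamma> borel fst. x \<in> F" unfolding D(4) by (rule F(2))
  then have AE: "AE z in \<gamma>. fst z \<in> F"
    by (rule AE_distrD[rotated]) measurable
  \<comment> \<open>One particle with atom \<open>x\<close> and destination \<open>z\<close>: each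
    atom other than \<open>x\<close> contributes one strip of bad directions, and the number of
    strips is bounded by \<open>card F\<close>.\<close>
  have point: "ennreal ((norm (z - x))\<^sup>2 / DIM('a)) \<le>
      (\<integral>\<^sup>+\<theta>. \<phi> \<theta> z \<partial>unif_sphere) + ennreal (real (card F) * K * t) * ennreal ((norm (z - x))\<^sup>2)"
    if x: "x \<in> F" "norm (z - x) \<le> w" for x z
  proof -
    let ?B = "\<lambda>y. {\<theta>. \<bar>((y - x) /\<^sub>R norm (y - x)) \<bullet> \<theta>\<bar> < t}"
    have B [measurable]: "?B y \<in> sets borel" for y by measurable
    have "ennreal ((norm (z - x))\<^sup>2 / DIM('a)) = (\<integral>\<^sup>+\<theta>. ennreal (((z - x) \<bullet> \<theta>)\<^sup>2) \<partial>unif_sphere)"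
      by (rule nn_integral_unif_sphere_inner_power2[symmetric])
    also have "\<dots> \<le> (\<integral>\<^sup>+\<theta>. \<phi> \<theta> z +
        (\<Sum>y\<in>F - {x}. ennreal ((norm (z - x))\<^sup>2) * indicator (?B y) \<theta>) \<partial>unif_sphere)"
    proof (rule nn_integral_mono_AE)
      show "AE \<theta> in unif_sphere. ennreal (((z - x) \<bullet> \<theta>)\<^sup>2) \<le> \<phi> \<theta> z +
          (\<Sum>y\<in>F - {x}. ennreal ((norm (z - x))\<^sup>2) * indicator (?B y) \<theta>)"
        using AE_unif_sphere
      proof eventually_elim
        case (elim \<theta>)
        have "l \<le> norm (y - x)" if "y \<in> F" "y \<noteq> x" for y
          using sep[OF x(1) that] by (simp add: dist_norm norm_minus_commute)
        from inner_power2_le_nearest[OF elim F(1) x(1) this x(2) w l]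
        show ?case by (simp add: \<phi>_def t_def)
      qed
    qed
    also have "\<dots> = (\<integral>\<^sup>+\<theta>. \<phi> \<theta> z \<partial>unif_sphere) +
        (\<Sum>y\<in>F - {x}. ennreal ((norm (z - x))\<^sup>2) * emeasure unif_sphere (?B y))"
      by (subst nn_integral_add, intro \<phi>_meas, simp, simp, measurable)
        (simp add: nn_integral_sum nn_integral_cmult_indicator)
    also have "(\<Sum>y\<in>F - {x}. ennreal ((norm (z - x))\<^sup>2) * emeasure unif_sphere (?B y)) \<le>
        (\<Sum>y\<in>F - {x}. ennreal ((norm (z - x))\<^sup>2) * ennreal (K * t))"
      by (intro sum_mono mult_left_mono strip t) auto
    also have "\<dots> = of_nat (card (F - {x})) * (ennreal ((norm (z - x))\<^sup>2) * ennreal (K * t))"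
      by simp
    also have "\<dots> \<le> of_nat (card F) * (ennreal ((norm (z - x))\<^sup>2) * ennreal (K * t))"
      using F(1) by (intro mult_right_mono of_nat_mono card_mono) auto
    also have "\<dots> = ennreal (real (card F) * K * t) * ennreal ((norm (z - x))\<^sup>2)"
      using K t by (simp add: ennreal_of_nat_eq_real_of_nat ennreal_mult[symmetric] mult_ac)
    finally show ?thesis by (simp add: add_left_mono)
  qed
  have "ennreal (k / DIM('a)) = (\<integral>\<^sup>+z. ennreal ((dist (fst z) (snd z))\<^sup>2 / DIM('a)) \<partial>\<gamma>)"
  proof -
    have "(\<integral>\<^sup>+z. ennreal ((dist (fst z) (snd z))\<^sup>2 / DIM('a)) \<partial>\<gamma>) =
        (\<integral>\<^sup>+z. ennreal ((dist (fst z) (snd z))\<^sup>2) * ennreal (1 / DIM('a)) \<partial>\<gamma>)"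
      by (simp add: ennreal_mult[symmetric])
    also have "\<dots> = ennreal k * ennreal (1 / DIM('a))"
      unfolding k(1)[symmetric] by (rule nn_integral_multc) measurable
    finally show ?thesis using k(2) by (simp add: ennreal_mult[symmetric])
  qed
  also have "\<dots> \<le> (\<integral>\<^sup>+z. (\<integral>\<^sup>+\<theta>. \<phi> \<theta> (snd z) \<partial>unif_sphere) +
      ennreal (real (card F) * K * t) * ennreal ((dist (fst z) (snd z))\<^sup>2) \<partial>\<gamma>)"
  proof (rule nn_integral_mono_AE)
    show "AE z in \<gamma>. ennreal ((dist (fst z) (snd z))\<^sup>2 / DIM('a)) \<le>
        (\<integral>\<^sup>+\<theta>. \<phi> \<theta> (snd z) \<partial>unif_sphere) +
        ennreal (real (card F) * K * t) * ennreal ((dist (fst z) (snd z))\<^sup>2)"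
      using AE \<gamma>(2)
    proof eventually_elim
      case (elim z)
      with point[of "fst z" "snd z"] show ?case
        by (simp add: dist_norm norm_minus_commute)
    qed
  qed
  also have "\<dots> = (\<integral>\<^sup>+z. (\<integral>\<^sup>+\<theta>. \<phi> \<theta> (snd z) \<partial>unif_sphere) \<partial>\<gamma>) +
      ennreal (real (card F) * K * t) * ennreal k"
    unfolding k(1)[symmetric]
  proof (subst nn_integral_add)
    show "(\<lambda>z. \<integral>\<^sup>+\<theta>. \<phi> \<theta> (snd z) \<partial>unif_sphere) \<in> borel_measurable \<gamma>"
      by (intro S.borel_measurable_nn_integral) (simp add: split_beta', intro \<phi>_meas, measurable)
  qed (auto intro: nn_integral_cmult)
  also have "(\<integral>\<^sup>+z. (\<integral>\<^sup>+\<theta>. \<phi> \<theta> (snd z) \<partial>unif_sphere) \<partial>\<gamma>) =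
      (\<integral>\<^sup>+\<theta>. (\<integral>\<^sup>+z. \<phi> \<theta> (snd z) \<partial>\<gamma>) \<partial>unif_sphere)"
    by (rule Pr.Fubini') (simp add: split_beta', intro \<phi>_meas, measurable)
  \<comment> \<open>After the exchange the integrand depends on the destination alone, whose law is
    \<open>\<nu>\<close>; \<open>\<gamma>\<close> disappears and the bound for arbitrary couplings
    of the projections applies.\<close>
  also have "\<dots> \<le> (\<integral>\<^sup>+\<theta>. ennreal ((W (proj \<theta> \<mu>) (proj \<theta> \<nu>))\<^sup>2) \<partial>unif_sphere)"
  proof (rule nn_integral_mono)
    fix \<theta> :: 'a
    have "(\<integral>\<^sup>+z. \<phi> \<theta> (snd z) \<partial>\<gamma>) = (\<integral>\<^sup>+z. \<phi> \<theta> z \<partial>\<nu>)"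
      unfolding D(5)[symmetric] by (rule nn_integral_distr[symmetric], measurable, intro \<phi>_meas, simp_all)
    then show "(\<integral>\<^sup>+z. \<phi> \<theta> (snd z) \<partial>\<gamma>) \<le> ennreal ((W (proj \<theta> \<mu>) (proj \<theta> \<nu>))\<^sup>2)"
      using W_proj_finite_support_ge[OF P F, of \<theta>] by (simp add: \<phi>_def)
  qed
  also have "\<dots> = ennreal ((SW \<mu> \<nu>)\<^sup>2)"
    by (rule ennreal_SW_power2[OF P, symmetric])
  finally have "ennreal (k / DIM('a)) \<le> ennreal ((SW \<mu> \<nu>)\<^sup>2) + ennreal (real (card F) * K * t) * ennreal k"
    by (simp add: add_right_mono)
  also have "\<dots> = ennreal ((SW \<mu> \<nu>)\<^sup>2 + real (card F) * K * t * k)"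
    using K t k(2) by (simp add: ennreal_mult[symmetric] ennreal_plus[symmetric] del: ennreal_plus)
  finally have le: "ennreal (k / DIM('a)) \<le> ennreal ((SW \<mu> \<nu>)\<^sup>2 + real (card F) * K * t * k)" .
  have "0 \<le> (SW \<mu> \<nu>)\<^sup>2 + real (card F) * K * t * k"
    using K t k(2) by simp
  from le[unfolded ennreal_le_iff[OF this]] show ?thesis
    by (simp only: t_def)
qed

lemma W_power2_le_SW_power2_near_finite_support:
  obtains C :: real where "C \<ge> 1"
    "\<And>(F :: 'a::euclidean_space set) \<mu> \<nu> \<gamma> w l.
       \<mu> \<in> P2 \<Longrightarrow> \<nu> \<in> P2 \<Longrightarrow> finite F \<Longrightarrow> AE x in \<mu>. x \<in> F \<Longrightarrow>
       (\<And>x y. x \<in> F \<Longrightarrow> y \<in> F \<Longrightarrow> y \<noteq> x \<Longrightarrow> l \<le> dist x y) \<Longrightarrow>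
       \<gamma> \<in> couplings \<mu> \<nu> \<Longrightarrow> AE z in \<gamma>. dist (fst z) (snd z) \<le> w \<Longrightarrow> 0 < w \<Longrightarrow> 0 < l \<Longrightarrow>
       4 * C * real (card F) * w < l \<Longrightarrow>
       (W \<mu> \<nu>)\<^sup>2 / DIM('a) \<le> (1 + 4 * C * real (card F) * w / l) * (SW \<mu> \<nu>)\<^sup>2"
proof -
  obtain K :: real where K: "K > 0"
    "\<And>(e::'a) t. norm e = 1 \<Longrightarrow> t > 0 \<Longrightarrow>
       emeasure unif_sphere {\<theta>. \<bar>e \<bullet> \<theta>\<bar> < t} \<le> ennreal (K * t)"
    using emeasure_unif_sphere_strip_le[where 'a='a] by metis
  \<comment> \<open>The factor \<open>DIM('a)\<close> appears because the error is measured in units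
    of \<open>k / DIM('a)\<close>, the quantity to be absorbed.\<close>
  define C where "C = max 1 (DIM('a) * K)"
  have "(W \<mu> \<nu>)\<^sup>2 / DIM('a) \<le> (1 + 4 * C * real (card F) * w / l) * (SW \<mu> \<nu>)\<^sup>2"
    if P: "\<mu> \<in> P2" "\<nu> \<in> P2" and F: "finite F" "AE x in \<mu>. x \<in> F"
      and sep: "\<And>x y. x \<in> F \<Longrightarrow> y \<in> F \<Longrightarrow> y \<noteq> x \<Longrightarrow> l \<le> dist x y"
      and \<gamma>: "\<gamma> \<in> couplings \<mu> \<nu>" "AE z in \<gamma>. dist (fst z) (snd z) \<le> w"
      and w: "0 < w" and l: "0 < l" and small: "4 * C * real (card F) * w < l"
    for F and \<mu> \<nu> :: "'a measure" and \<gamma> w l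
  proof -
    define k where "k = enn2real (\<integral>\<^sup>+z. ennreal ((dist (fst z) (snd z))\<^sup>2) \<partial>\<gamma>)"
    have "(\<integral>\<^sup>+z. ennreal ((dist (fst z) (snd z))\<^sup>2) \<partial>\<gamma>) < \<infinity>"
      by (rule le_less_trans[OF nn_integral_dist_coupling[OF P \<gamma>(1)]])
        (use P2_moment_finite[OF P(1)] P2_moment_finite[OF P(2)] in \<open>auto simp: ennreal_mult_less_top\<close>)
    then have k: "(\<integral>\<^sup>+z. ennreal ((dist (fst z) (snd z))\<^sup>2) \<partial>\<gamma>) = ennreal k" "0 \<le> k"
      by (auto simp: k_def)
    \<comment> \<open>The relative error; smallness of \<open>w\<close> says
      \<open>2 * e < 1\<close>, and \<open>2 * e\<close> is the error term of the claim.\<close>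
    define e where "e = 2 * C * real (card F) * w / l"
    have e: "0 \<le> e" "e \<le> 1 / 2"
      using small l w by (auto simp: e_def C_def field_simps)
    have "k / DIM('a) \<le> (SW \<mu> \<nu>)\<^sup>2 + real (card F) * K * (2 * w / l) * k"
      by (rule SW_power2_ge_coupling_cost[OF K(2) _ P F sep \<gamma> w l k]) (use K(1) in auto)
    also have "real (card F) * K * (2 * w / l) * k =
        (DIM('a) * K) * (2 * real (card F) * w / l) * (k / DIM('a))"
      by (simp add: field_simps)
    also have "\<dots> \<le> C * (2 * real (card F) * w / l) * (k / DIM('a))"
      using w l k(2) by (intro mult_right_mono) (auto simp: C_def)
    also have "C * (2 * real (card F) * w / l) = e"
      by (simp add: e_def)
    finally have "(1 - e) * (k / DIM('a)) \<le> (SW \<mu> \<nu>)\<^sup>2"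
      by (simp add: left_diff_distrib diff_divide_distrib)
    then have "(1 + 2 * e) * ((1 - e) * (k / DIM('a))) \<le> (1 + 2 * e) * (SW \<mu> \<nu>)\<^sup>2"
      using e by (intro mult_left_mono) auto
    moreover have "1 * (k / DIM('a)) \<le> (1 + 2 * e) * (1 - e) * (k / DIM('a))"
    proof (intro mult_right_mono)
      \<comment> \<open>This is exactly \<open>(1 + 2 * e) * (1 - e) - 1\<close>, so multiplying by
        \<open>1 + 2 * e\<close> undoes the factor \<open>1 - e\<close>.\<close>
      have "0 \<le> e * (1 - 2 * e)" using e by (intro mult_nonneg_nonneg) auto
      then show "1 \<le> (1 + 2 * e) * (1 - e)" by (simp add: algebra_simps)
    qed (use k(2) in auto)
    moreover have "(W \<mu> \<nu>)\<^sup>2 / DIM('a) \<le> k / DIM('a)"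
      using ennreal_W_power2_le[OF P \<gamma>(1)] k by (intro divide_right_mono) auto
    ultimately show ?thesis
      by (simp add: e_def mult.assoc)
  qed
  moreover have "C \<ge> 1" by (simp add: C_def)
  ultimately show thesis by (rule that[rotated])
qed

section \<open>Discrete measures and the distance \<open>W_infty\<close>\<close>

lemma discrete_measure_support:
  assumes m: "\<forall>i\<in>{1..n}. m i > 0" "(\<Sum>i=1..n. m i) = 1"
  shows "discrete_measure n m y \<in> P2" "AE x in discrete_measure n m y. x \<in> y ` {1..n}"
proof -
  let ?M = "point_measure {1..n} (\<lambda>i. ennreal (m i))"
  have y: "y \<in> borel_measurable ?M" by simp
  have "prob_space ?M"
  proof (rule prob_spaceI)
    have "(\<Sum>i=1..n. ennreal (m i)) = ennreal (\<Sum>i=1..n. m i)"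
      using m(1) by (intro sum_ennreal) (auto intro: less_imp_le)
    then show "emeasure ?M (space ?M) = 1"
      using m(2) by (simp add: space_point_measure emeasure_point_measure_finite)
  qed
  moreover have "(\<integral>\<^sup>+i. ennreal ((norm (y i))\<^sup>2) \<partial>?M) < \<infinity>"
    by (simp add: nn_integral_point_measure_finite less_top[symmetric] ennreal_mult_eq_top_iff)
  ultimately show "discrete_measure n m y \<in> P2"
    unfolding discrete_measure_def by (intro distr_in_P2 y)
  have "closed (y ` {1..n})" by (intro finite_imp_closed) auto
  then have "y ` {1..n} \<in> sets borel" by (rule borel_closed)
  then show "AE x in discrete_measure n m y. x \<in> y ` {1..n}"
    unfolding discrete_measure_def by (subst AE_distr_iff) (auto simp: space_point_measure)
qed

text \<open>Total mass 1 matters here: over a null measure the essential supremum would be minus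
  infinity.\<close>

lemma W_infty_nonneg:
  assumes "prob_space \<mu>"
  shows "0 \<le> W_infty \<mu> \<nu>"
  unfolding W_infty_def
proof (rule INF_greatest)
  fix \<gamma> assume \<gamma>: "\<gamma> \<in> couplings \<mu> \<nu>"
  interpret \<gamma>: prob_space \<gamma> by (rule coupling_D(2)[OF \<gamma> assms])
  have "AE z in \<gamma>. ereal (dist (fst z) (snd z)) \<le> esssup \<gamma> (\<lambda>z. ereal (dist (fst z) (snd z)))"
    by (rule esssup_AE)
  then have "AE z in \<gamma>. 0 \<le> esssup \<gamma> (\<lambda>z. ereal (dist (fst z) (snd z)))"
    by eventually_elim (auto elim: order_trans[rotated])
  then show "0 \<le> esssup \<gamma> (\<lambda>z. ereal (dist (fst z) (snd z)))" by simp
qed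

lemma W_infty_less_imp_coupling:
  assumes "W_infty \<mu> \<nu> < ereal w"
  obtains \<gamma> where "\<gamma> \<in> couplings \<mu> \<nu>" "AE z in \<gamma>. dist (fst z) (snd z) \<le> w"
proof -
  obtain \<gamma> where \<gamma>: "\<gamma> \<in> couplings \<mu> \<nu>" "esssup \<gamma> (\<lambda>z. ereal (dist (fst z) (snd z))) < ereal w"
    using assms unfolding W_infty_def by (auto simp: INF_less_iff)
  have "AE z in \<gamma>. dist (fst z) (snd z) \<le> w"
    using esssup_AE[of "\<lambda>z. ereal (dist (fst z) (snd z))" \<gamma>]
  proof eventually_elim
    case (elim z)
    from this \<gamma>(2) have "ereal (dist (fst z) (snd z)) < ereal w" by (rule le_less_trans)
    then show ?case by simp
  qed
  with \<gamma>(1) show thesis by (rule that)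
qed

theorem theorem5p5:
  assumes "CARD('d::finite) \<ge> 2"
  shows "\<exists>C::real. C \<ge> 1 \<and>
    (\<forall>(n::nat) (m::nat \<Rightarrow> real) (y::nat \<Rightarrow> real^'d) (\<mu>::(real^'d) measure) (\<nu>::(real^'d) measure).
       (\<forall>i\<in>{1..n}. m i > 0) \<longrightarrow> (\<Sum>i=1..n. m i) = 1 \<longrightarrow> inj_on y {1..n} \<longrightarrow>
       \<mu> = discrete_measure n m y \<longrightarrow> \<nu> \<in> P2 \<longrightarrow>
       W_infty \<mu> \<nu> < min_separation n y / ereal (4 * C * real n) \<longrightarrow>
       (0 \<le> 1 / real CARD('d) * (W \<mu> \<nu>)\<^sup>2 - (SW \<mu> \<nu>)\<^sup>2 \<and>
        ereal (1 / real CARD('d) * (W \<mu> \<nu>)\<^sup>2 - (SW \<mu> \<nu>)\<^sup>2)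
          \<le> ereal (4 * C * real n) / min_separation n y * W_infty \<mu> \<nu> * ereal ((SW \<mu> \<nu>)\<^sup>2)) \<and>
       (ereal ((SW \<mu> \<nu>)\<^sup>2) \<le> (ell_SW \<mu> \<nu>)\<^sup>2 \<and>
        (ell_SW \<mu> \<nu>)\<^sup>2 \<le> ereal (1 / real CARD('d) * (W \<mu> \<nu>)\<^sup>2) \<and>
        ereal (1 / real CARD('d) * (W \<mu> \<nu>)\<^sup>2)
          \<le> (1 + ereal (4 * C * real n) / min_separation n y * W_infty \<mu> \<nu>) * ereal ((SW \<mu> \<nu>)\<^sup>2)))"
proof -
  obtain C :: real where C: "C \<ge> 1"
    and main: "\<And>(F :: (real^'d) set) \<mu> \<nu> \<gamma> w l.
       \<mu> \<in> P2 \<Longrightarrow> \<nu> \<in> P2 \<Longrightarrow> finite F \<Longrightarrow> AE x in \<mu>. x \<in> F \<Longrightarrow>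
       (\<And>x y. x \<in> F \<Longrightarrow> y \<in> F \<Longrightarrow> y \<noteq> x \<Longrightarrow> l \<le> dist x y) \<Longrightarrow>
       \<gamma> \<in> couplings \<mu> \<nu> \<Longrightarrow> AE z in \<gamma>. dist (fst z) (snd z) \<le> w \<Longrightarrow> 0 < w \<Longrightarrow> 0 < l \<Longrightarrow>
       4 * C * real (card F) * w < l \<Longrightarrow>
       (W \<mu> \<nu>)\<^sup>2 / DIM(real^'d) \<le> (1 + 4 * C * real (card F) * w / l) * (SW \<mu> \<nu>)\<^sup>2"
    using W_power2_le_SW_power2_near_finite_support[where 'a="real^'d"] by blast
  show ?thesis
  proof (intro exI[of _ C] conjI allI impI)
    show "C \<ge> 1" by (rule C)
  next
    fix n m and y :: "nat \<Rightarrow> real^'d" and \<mu> \<nu>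
    assume m: "\<forall>i\<in>{1..n}. m i > 0" "(\<Sum>i=1..n. m i) = (1::real)" and y: "inj_on y {1..n}"
      and \<mu>: "\<mu> = discrete_measure n m y" and \<nu>: "\<nu> \<in> P2"
      and small: "W_infty \<mu> \<nu> < min_separation n y / ereal (4 * C * real n)"
    let ?F = "y ` {1..n}"
    \<comment> \<open>Masses with sum 1 exclude the empty family, so the threshold has a positive
      denominator.\<close>
    have n: "0 < n" using m(2) by (cases n) auto
    have a: "0 < 4 * C * real n" using C n by simp
    have \<mu>P: "\<mu> \<in> P2" and \<mu>F: "AE x in \<mu>. x \<in> ?F"
      unfolding \<mu> by (rule discrete_measure_support[OF m])+
    have cF: "card ?F = n" using y by (simp add: card_image)
    have W0: "0 \<le> W_infty \<mu> \<nu>" by (rule W_infty_nonneg[OF P2_D(2)[OF \<mu>P]])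
    obtain w0 where w0: "W_infty \<mu> \<nu> = ereal w0" "0 \<le> w0"
      using W0 small by (cases "W_infty \<mu> \<nu>") auto
    \<comment> \<open>\<open>w\<close> lies strictly above \<open>W_infty\<close> to obtain a
      coupling, and \<open>l\<close> is any real number not above the separation, which may be
      infinite.\<close>
    have bound: "(W \<mu> \<nu>)\<^sup>2 / CARD('d) \<le> (1 + 4 * C * real n * w / l) * (SW \<mu> \<nu>)\<^sup>2"
      if "w0 < w" "4 * C * real n * w < l" "ereal l \<le> min_separation n y" for w l
    proof -
      have "W_infty \<mu> \<nu> < ereal w"
        using that(1) by (simp add: w0)
      then obtain \<gamma> where \<gamma>: "\<gamma> \<in> couplings \<mu> \<nu>" "AE z in \<gamma>. dist (fst z) (snd z) \<le> w"
        by (rule W_infty_less_imp_coupling)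
      have sep: "l \<le> dist x x'" if xx': "x \<in> ?F" "x' \<in> ?F" "x' \<noteq> x" for x x'
      proof -
        obtain i j where ij: "i \<in> {1..n}" "j \<in> {1..n}" "x = y i" "x' = y j"
          using xx' by auto
        then have "min_separation n y \<le> ereal (dist x x')"
          unfolding min_separation_def using xx'(3) by (intro INF_lower2[of "(i, j)"]) auto
        with \<open>ereal l \<le> min_separation n y\<close> have "ereal l \<le> ereal (dist x x')"
          by (rule order_trans)
        then show ?thesis by simp
      qed
      have "0 < w" using that(1) w0(2) by simp
      moreover have "0 < l" using that(2) mult_pos_pos[OF a \<open>0 < w\<close>] by linarith
      ultimately show ?thesis
        using main[OF \<mu>P \<nu> _ \<mu>F sep \<gamma>, unfolded cF] that(2) by simp
    qed
    \<comment> \<open>Once the extended product is known to be a real \<open>r\<close>, all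
      remaining claims are inequalities between reals.\<close>
    obtain r where r: "ereal (4 * C * real n) / min_separation n y * W_infty \<mu> \<nu> = ereal r"
      and le: "(W \<mu> \<nu>)\<^sup>2 / CARD('d) \<le> (1 + r) * (SW \<mu> \<nu>)\<^sup>2"
    proof (cases "min_separation n y")
      case (real l)
      have less: "4 * C * real n * w0 < l"
        using small n C by (simp add: w0 real field_simps)
      have l: "0 < l" using less mult_nonneg_nonneg[of "4 * C * real n" w0] a w0(2) by linarith
      have "(W \<mu> \<nu>)\<^sup>2 / CARD('d) \<le> (1 + 4 * C * real n * w0 / l) * (SW \<mu> \<nu>)\<^sup>2"
      \<comment> \<open>The strict hypothesis leaves an interval of admissible \<open>w\<close> to
        the right of \<open>w0\<close>; the bound is continuous in \<open>w\<close> and passes to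
        the limit.\<close>
      proof (rule tendsto_lowerbound)
        show "((\<lambda>w. (1 + 4 * C * real n * w / l) * (SW \<mu> \<nu>)\<^sup>2) \<longlongrightarrow>
            (1 + 4 * C * real n * w0 / l) * (SW \<mu> \<nu>)\<^sup>2) (at_right w0)"
          using l by (intro tendsto_intros) auto
        have "w0 < l / (4 * C * real n)" using less a by (simp add: field_simps)
        then show "\<forall>\<^sub>F w in at_right w0. (W \<mu> \<nu>)\<^sup>2 / CARD('d) \<le> (1 + 4 * C * real n * w / l) * (SW \<mu> \<nu>)\<^sup>2"
          unfolding eventually_at_right_field
        proof (intro exI conjI allI impI)
          fix w assume "w0 < w" "w < l / (4 * C * real n)"
          then show "(W \<mu> \<nu>)\<^sup>2 / CARD('d) \<le> (1 + 4 * C * real n * w / l) * (SW \<mu> \<nu>)\<^sup>2"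
            using a by (intro bound) (auto simp: real pos_less_divide_eq mult.commute)
        qed
      qed simp
      then show thesis
        using l by (intro that[of "4 * C * real n * w0 / l"]) (auto simp: w0 real)
    next
      \<comment> \<open>A single atom: the quotient by the infinite separation is 0. With
        \<open>w0 + 1\<close> as a fixed admissible \<open>w\<close>, the error term vanishes as
        \<open>l\<close> tends to infinity.\<close>
      case PInf
      have "(W \<mu> \<nu>)\<^sup>2 / CARD('d) \<le> (1 + 0) * (SW \<mu> \<nu>)\<^sup>2"
      proof (rule tendsto_lowerbound)
        show "((\<lambda>l. (1 + 4 * C * real n * (w0 + 1) / l) * (SW \<mu> \<nu>)\<^sup>2) \<longlongrightarrow>
            (1 + 0) * (SW \<mu> \<nu>)\<^sup>2) at_top"
          by (intro tendsto_intros tendsto_divide_0[OF tendsto_const] filterlim_at_top_imp_at_infinity filterlim_ident)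
        show "\<forall>\<^sub>F l in at_top. (W \<mu> \<nu>)\<^sup>2 / CARD('d) \<le> (1 + 4 * C * real n * (w0 + 1) / l) * (SW \<mu> \<nu>)\<^sup>2"
          using eventually_gt_at_top[of "4 * C * real n * (w0 + 1)"]
          by eventually_elim (intro bound, auto simp: PInf)
      qed simp
      then show thesis
        by (intro that[of 0]) (auto simp: w0 PInf)
    next
      \<comment> \<open>Ruled out, as \<open>W_infty\<close> would be nonnegative and below minus
        infinity.\<close>
      case MInf
      with small W0 a show thesis by (auto simp: w0)
    qed
    have lower: "(SW \<mu> \<nu>)\<^sup>2 \<le> (W \<mu> \<nu>)\<^sup>2 / CARD('d)"
      using SW_power2_le_W_power2[OF \<mu>P \<nu>] by simp
    show "0 \<le> 1 / real CARD('d) * (W \<mu> \<nu>)\<^sup>2 - (SW \<mu> \<nu>)\<^sup>2"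
      using lower by simp
    show "ereal (1 / real CARD('d) * (W \<mu> \<nu>)\<^sup>2 - (SW \<mu> \<nu>)\<^sup>2)
          \<le> ereal (4 * C * real n) / min_separation n y * W_infty \<mu> \<nu> * ereal ((SW \<mu> \<nu>)\<^sup>2)"
      unfolding r using le by (simp add: algebra_simps)
    show "ereal ((SW \<mu> \<nu>)\<^sup>2) \<le> (ell_SW \<mu> \<nu>)\<^sup>2"
      by (rule ell_SW_power2_bounds[OF \<mu>P \<nu>])
    show "(ell_SW \<mu> \<nu>)\<^sup>2 \<le> ereal (1 / real CARD('d) * (W \<mu> \<nu>)\<^sup>2)"
      using ell_SW_power2_bounds(2)[OF \<mu>P \<nu>] by simp
    show "ereal (1 / real CARD('d) * (W \<mu> \<nu>)\<^sup>2)
          \<le> (1 + ereal (4 * C * real n) / min_separation n y * W_infty \<mu> \<nu>) * ereal ((SW \<mu> \<nu>)\<^sup>2)"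
      unfolding r using le by (simp add: one_ereal_def)
  qed
qed

end
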